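(* Let $\mathbb{F}=\mathbb{R}$ or $\mathbb{F}=\mathbb{C}$, and set $\alpha=1$ if $\mathbb{F}=\mathbb{R}$, $\alpha=0$ if $\mathbb{F}=\mathbb{C}$. Let $A\in\mathbb{F}^{m\times n}$ be a fixed matrix, and let $k,\ell$ be positive integers with $k\le n$, $\ell\le m$ and $\ell>k+\alpha$. Draw $\Omega\in\mathbb{F}^{n\times k}$ and $\Psi\in\mathbb{F}^{\ell\times m}$ independently from the standard normal distribution over $\mathbb{F}$. Let $\hat A=QX$ be the rank-$k$ approximation of $A$ computed from the sketch $(A\Omega,\Psi A)$, as defined in the context. Then $$ \mathbb{E}\,\|A-\hat A\|_{\mathrm F}^2 \;\le\; (1+f(k,\ell))\cdot\min_{\varrho<k-\alpha}\,(1+f(\varrho,k))\cdot\tau_{\varrho+1}^2(A) \;=\;\frac{\ell-\alpha}{\ell-k-\alpha}\cdot\min_{\varrho<k-\alpha}\frac{k-\alpha}{k-\varrho-\alpha}\cdot\tau_{\varrho+1}^2(A), $$ where the index $\varrho$ ranges over natural numbers $\varrho\ge 1$ with $\varrho<k-\alpha$ (a minimum over the empty set is $+\infty$).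
   Context: Standard normal matrices: a real standard normal matrix has independent $N(0,1)$ entries; a complex standard normal matrix is $G_1+\mathrm{i}G_2$ with $G_1,G_2$ independent real standard normal matrices. $f(s,t):=s/(t-s-\alpha)$ for integers with $t>s+\alpha>\alpha$. Tail energy: $\tau_j^2(A):=\min_{\operatorname{rank}(B)<j}\|A-B\|_{\mathrm F}^2=\sum_{i\ge j}\sigma_i^2(A)$, where $\sigma_i(A)$ is the $i$th largest singular value (zero for $i>\min\{m,n\}$) and $\|\cdot\|_{\mathrm F}$ is the Frobenius norm. The approximation: form $Y:=A\Omega\in\mathbb{F}^{m\times k}$ and $W:=\Psi A\in\mathbb{F}^{\ell\times n}$. Compute an orthogonal--triangular (QR) factorization $Y=QR$, where $Q\in\mathbb{F}^{m\times k}$ has orthonormal columns; $Q$ is obtained from $Y$ by a fixed (measurable) procedure, so it is a function of $\Omega$ only (for fixed $A$). Set $X:=(\Psi Q)^\dagger W\in\mathbb{F}^{k\times n}$, where $\dagger$ is the Moore--Penrose pseudoinverse, and $\hat A:=QX$. $\mathbb{E}$ is expectation over both $\Omega$ and $\Psi$. *)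

theory Defs
  imports "HOL-Probability.Probability" "Jordan_Normal_Form.Conjugate"
begin

text \<open>An \<open>m \<times> n\<close> matrix over the field is an element of \<open>'f^'n^'m\<close>. The norm of this type
  is the Frobenius norm:\<close>

lemma norm_matrix_eq_frobenius:
  fixes A :: "'f::real_normed_vector^'n^'m"
  shows "(norm A)\<^sup>2 = (\<Sum>i\<in>UNIV. \<Sum>j\<in>UNIV. (norm (A $ i $ j))\<^sup>2)"
  by (simp add: norm_vec_def L2_set_def sum_nonneg)

definition conj_transpose :: "'f::conjugate^'n^'m \<Rightarrow> 'f^'m^'n" where
  "conj_transpose A = (\<chi> i j. conjugate (A $ j $ i))"

definition is_pinv :: "'f::conjugatable_field^'n^'m \<Rightarrow> 'f^'m^'n \<Rightarrow> bool" where
  "is_pinv A X \<longleftrightarrow>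
     A ** X ** A = A \<and> X ** A ** X = X \<and>
     conj_transpose (A ** X) = A ** X \<and> conj_transpose (X ** A) = X ** A"

text \<open>Over the reals and the complex numbers, exactly one matrix satisfies the four Penrose
  equations.\<close>

definition pinv :: "'f::conjugatable_field^'n^'m \<Rightarrow> 'f^'m^'n" where
  "pinv A = (THE X. is_pinv A X)"

definition orthonormal_columns :: "'f::conjugatable_field^'k^'m \<Rightarrow> bool" where
  "orthonormal_columns Q \<longleftrightarrow> conj_transpose Q ** Q = mat 1"

definition upper_tri :: "'f::zero^'k::{finite,linorder}^'k::{finite,linorder} \<Rightarrow> bool" where
  "upper_tri R \<longleftrightarrow> (\<forall>i j. j < i \<longrightarrow> R $ i $ j = 0)"

definition qr_factor :: "'f::conjugatable_field^'k::{finite,linorder}^'m \<Rightarrow> 'f^'k::{finite,linorder}^'m \<Rightarrow> bool" where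
  "qr_factor Y Q \<longleftrightarrow> orthonormal_columns Q \<and> (\<exists>R. upper_tri R \<and> Y = Q ** R)"

text \<open>A measurable rule choosing the orthonormal factor of a QR factorization of every matrix.
  Such a factor is not unique (in particular when the matrix is rank-deficient), so the rule is
  a parameter.\<close>

definition qr_procedure ::
  "('f::{conjugatable_field,topological_space}^'k::{finite,linorder}^'m \<Rightarrow> 'f^'k::{finite,linorder}^'m) \<Rightarrow> bool" where
  "qr_procedure qr \<longleftrightarrow> qr \<in> borel_measurable borel \<and> (\<forall>Y. qr_factor Y (qr Y))"

definition sketch_approx ::
  "('f::conjugatable_field^'k^'m \<Rightarrow> 'f^'k^'m) \<Rightarrow> 'f^'n^'m \<Rightarrow> 'f^'k^'n \<Rightarrow> 'f^'m^'l \<Rightarrow> 'f^'n^'m" where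
  "sketch_approx qr A \<Omega> \<Psi> =
     (let Y = A ** \<Omega>; W = \<Psi> ** A; Q = qr Y; X = pinv (\<Psi> ** Q) ** W in Q ** X)"

text \<open>The squared tail energy. For \<open>j \<ge> 1\<close> the infimum is attained (Eckart--Young), since the
  matrices of rank less than \<open>j\<close> form a nonempty closed set.\<close>

definition tail_energy_sq ::
  "nat \<Rightarrow> 'f::{field,real_normed_vector}^'n^'m \<Rightarrow> real" where
  "tail_energy_sq j A = (INF B\<in>{B. rank B < j}. (norm (A - B))\<^sup>2)"

definition sketch_f :: "nat \<Rightarrow> nat \<Rightarrow> nat \<Rightarrow> real" where
  "sketch_f \<alpha> s t = real s / (real t - real s - real \<alpha>)"

text \<open>The library's \<open>indep_var\<close> forces both random variables to have the same type, which excludes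
  \<open>\<Omega>\<close> and \<open>\<Psi>\<close>.\<close>

definition indep_rvs ::
  "'w measure \<Rightarrow> ('w \<Rightarrow> 'a::topological_space) \<Rightarrow> ('w \<Rightarrow> 'b::topological_space) \<Rightarrow> bool" where
  "indep_rvs M X Y \<longleftrightarrow>
     X \<in> borel_measurable M \<and> Y \<in> borel_measurable M \<and>
     prob_space.indep_set M {X -` S \<inter> space M | S. S \<in> sets borel}
                            {Y -` S \<inter> space M | S. S \<in> sets borel}"

definition real_std_normal_matrix :: "'w measure \<Rightarrow> ('w \<Rightarrow> real^'c^'r) \<Rightarrow> bool" where
  "real_std_normal_matrix M G \<longleftrightarrow>
     prob_space.indep_vars M (\<lambda>_. borel) (\<lambda>(i, j) \<omega>. G \<omega> $ i $ j) UNIV \<and>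
     (\<forall>i j. distributed M lborel (\<lambda>\<omega>. G \<omega> $ i $ j) std_normal_density)"

text \<open>The decomposition \<open>G = G\<^sub>1 + \<i> G\<^sub>2\<close> with real \<open>G\<^sub>1\<close>, \<open>G\<^sub>2\<close> is unique, so \<open>G\<^sub>1\<close> and \<open>G\<^sub>2\<close> are
  the entrywise real and imaginary parts. The entries have variance 2, not 1.\<close>

definition complex_std_normal_matrix :: "'w measure \<Rightarrow> ('w \<Rightarrow> complex^'c^'r) \<Rightarrow> bool" where
  "complex_std_normal_matrix M G \<longleftrightarrow>
     (let G1 = (\<lambda>\<omega>. \<chi> i j. Re (G \<omega> $ i $ j)); G2 = (\<lambda>\<omega>. \<chi> i j. Im (G \<omega> $ i $ j))
      in real_std_normal_matrix M G1 \<and> real_std_normal_matrix M G2 \<and>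
         indep_rvs M G1 G2)"

end

theory Submission
  imports Defs
begin

text \<open>Let \<open>P\<close> be the orthogonal projection onto the span of an orthonormal family \<open>v\<^sub>1, \<dots>, v\<^sub>r\<close> and
  \<open>\<Omega>\<close> a Gaussian matrix. Then \<open>P\<Omega>\<close> and \<open>(I - P)\<Omega>\<close> are independent, and \<open>T = (P\<Omega>)\<^sup>\<dagger>\<close> satisfies
  \<open>T P = T\<close> and \<open>P\<Omega>T = P\<close>, so \<open>A - A\<Omega>T\<close> splits into the orthogonal parts \<open>A(I - P)\<close> and
  \<open>- A(I - P)\<Omega>T\<close>. Averaging the second one over \<open>(I - P)\<Omega>\<close> gives a multiple of
  \<open>\<parallel>A(I - P)\<parallel>\<^sup>2 \<parallel>T\<parallel>\<^sup>2\<close>, and \<open>\<parallel>T\<parallel>\<^sup>2\<close> is the sum of the inverse squared distances of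
  each \<open>\<Omega>\<^sup>* v\<^sub>j\<close> from the span of the others, i.e. of inverse chi-square variables with known mean.

  Both halves of the error bound are instances. For the range finder, \<open>P\<close> projects onto the row
  space of a competitor of low rank, and \<open>A - QQ\<^sup>*A\<close> is no larger than \<open>A - A\<Omega>T\<close> because
  \<open>QQ\<^sup>*\<close> fixes the range of \<open>A\<Omega>\<close>. For the least-squares step, \<open>P = QQ\<^sup>*\<close> and the error
  is the adjoint of \<open>A\<^sup>* - A\<^sup>*\<Psi>\<^sup>*T\<close>.

  Measurability of the pseudoinverse is never needed: \<open>nn_integral\<close> is a lower integral, so for
  arbitrary functions Tonelli and the change of variables still hold as the inequalities used here.\<close>

section \<open>Real and complex scalars, and the standard Gaussian measure\<close>

text \<open>The axioms say that the real inner product is the real part of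
  \<open>conjugate x * y\<close>, and that \<open>conjugate x * x\<close> is the squared norm. One
  proof then serves both scalar fields, which differ only through \<open>DIM('f)\<close>, equal to 1
  or 2.\<close>

class rc_field = real_normed_field + conjugatable_field + euclidean_space +
  assumes inner_eq_inner_one: "inner x y = inner 1 (conjugate x * y)"
    and conjugate_mult_self: "conjugate x * x = scaleR ((norm x)\<^sup>2) 1"

instance real :: rc_field
  by standard (auto simp: power2_eq_square)

instance complex :: rc_field
proof
  show "inner x y = inner 1 (conjugate x * y)" for x y :: complex
    by (simp add: inner_complex_def)
  show "conjugate x * x = scaleR ((norm x)\<^sup>2) 1" for x :: complex
    using complex_norm_square[of x] by (simp add: scaleR_conv_of_real mult.commute)
qed

text \<open>Every real coordinate has variance 1. A complex entry therefore has variance 2, in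
  agreement with \<open>complex_std_normal_matrix\<close>.\<close>

definition gauss :: "'a::euclidean_space measure" where
  "gauss = density lborel (\<lambda>x. ennreal (\<Prod>b\<in>Basis. std_normal_density (x \<bullet> b)))"

lemma sets_gauss [simp, measurable_cong]: "sets gauss = sets borel"
  and space_gauss [simp]: "space gauss = UNIV"
  by (auto simp: gauss_def)

lemma nn_integral_std_normal_density: "(\<integral>\<^sup>+x. ennreal (std_normal_density x) \<partial>lborel) = 1"
  using prob_space.emeasure_space_1[OF prob_space_normal_density[of 1 0]]
  by (simp add: emeasure_density)

text \<open>The product density depends on the norm alone. Invariance under linear isometries and
  the product formula for pairs both rest on this form.\<close>

lemma gauss_density_eq:
  "(\<Prod>b\<in>Basis. std_normal_density (x \<bullet> b)) =
     (1 / sqrt (2 * pi)) ^ DIM('a) * exp (- (norm x)\<^sup>2 / 2)" for x :: "'a::euclidean_space"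
proof -
  have "(\<Prod>b\<in>Basis. std_normal_density (x \<bullet> b)) =
     (1 / sqrt (2 * pi)) ^ DIM('a) * (\<Prod>b\<in>Basis. exp (- (x \<bullet> b)\<^sup>2 / 2))"
    by (simp only: std_normal_density_def prod.distrib prod_constant)
  also have "(\<Prod>b\<in>Basis. exp (- (x \<bullet> b)\<^sup>2 / 2)) = exp (\<Sum>b\<in>Basis. - (x \<bullet> b)\<^sup>2 / 2)"
    by (simp add: exp_sum)
  also have "(\<Sum>b\<in>Basis. - (x \<bullet> b)\<^sup>2 / 2) = - (norm x)\<^sup>2 / 2"
    by (simp add: norm_eq_sqrt_inner euclidean_inner[of x x] power2_eq_square sum_divide_distrib sum_negf sum_nonneg)
  finally show ?thesis .
qed

interpretation gauss: prob_space "gauss :: 'a::euclidean_space measure"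
proof
  have "emeasure (gauss::'a measure) (space gauss) =
      (\<integral>\<^sup>+x. (\<Prod>b\<in>Basis. ennreal (std_normal_density ((x::'a) \<bullet> b))) \<partial>lborel)"
    by (simp add: gauss_def emeasure_density prod_ennreal)
  also have "\<dots> = 1"
    by (subst nn_integral_lborel_prod) (auto simp: nn_integral_std_normal_density)
  finally show "emeasure (gauss::'a measure) (space gauss) = 1" .
qed

lemma gauss_real: "(gauss :: real measure) = density lborel std_normal_density"
  by (simp add: gauss_def)

lemma gauss_Pair: "(gauss :: 'a::euclidean_space measure) \<Otimes>\<^sub>M (gauss :: 'b::euclidean_space measure) = gauss"
proof -
  have *: "ennreal (\<Prod>b\<in>Basis. std_normal_density (x \<bullet> b)) * ennreal (\<Prod>b\<in>Basis. std_normal_density (y \<bullet> b))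
     = ennreal (\<Prod>b\<in>Basis. std_normal_density ((x, y) \<bullet> b))" for x :: 'a and y :: 'b
    unfolding gauss_density_eq
    by (simp add: norm_Pair ennreal_mult[symmetric] power_add exp_add[symmetric] add_divide_distrib)
  show ?thesis
    unfolding gauss_def
    apply (subst pair_measure_density)
    apply (use sigma_finite_lborel gauss.sigma_finite_measure_axioms in
        \<open>auto simp: gauss_def lborel_prod *\<close>)
    apply (rule arg_cong[where f="density lborel"])
    apply auto
    done
qed

text \<open>Fubini's theorem for \<open>f x * g (x + y)\<close> shows that translation-invariant measures are
  proportional; the unit ball, which \<open>T\<close> preserves, fixes the factor.\<close>

lemma distr_lborel_isometry:
  fixes T :: "'a::euclidean_space \<Rightarrow> 'a"
  assumes T: "orthogonal_transformation T"
  shows "distr lborel borel T = lborel"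
proof -
  obtain S where S: "orthogonal_transformation S" "\<And>x. S (T x) = x" "\<And>x. T (S x) = x"
    using T by (metis inv_f_f orthogonal_transformation_inj orthogonal_transformation_inv
        orthogonal_transformation_surj surj_f_inv_f)
  have cont: "T \<in> borel_measurable borel" "S \<in> borel_measurable borel"
    using T S by (auto intro!: borel_measurable_continuous_onI linear_continuous_on
        simp: orthogonal_transformation_def linear_conv_bounded_linear)
  note [measurable] = cont
  define \<mu> where "\<mu> = distr lborel borel T"
  have sets\<mu> [simp, measurable_cong]: "sets \<mu> = sets borel" and sp [simp]: "space \<mu> = UNIV"
    by (auto simp: \<mu>_def)
  \<comment> \<open>\<open>T\<close> preserves centred balls. This makes \<mu> sigma-finite, as
    Fubini requires, and later fixes the constant of proportionality.\<close>
  have ball: "emeasure \<mu> (ball 0 r) = emeasure lborel (ball 0 r :: 'a set)" for r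
  proof -
    have "T -` ball 0 r = ball 0 r"
      using T by (auto simp: orthogonal_transformation)
    then show ?thesis by (simp add: \<mu>_def emeasure_distr)
  qed
  interpret mu: sigma_finite_measure \<mu>
  proof
    show "\<exists>A. countable A \<and> A \<subseteq> sets \<mu> \<and> \<Union>A = space \<mu> \<and> (\<forall>a\<in>A. emeasure \<mu> a \<noteq> \<infinity>)"
      using emeasure_lborel_ball_finite[where 'a='a]
      by (intro exI[of _ "range (\<lambda>n::nat. ball 0 (real n))"])
         (auto simp: ball less_top[symmetric] intro: reals_Archimedean2)
  qed
  interpret P: pair_sigma_finite \<mu> "lborel :: 'a measure" ..
  have transl: "(\<integral>\<^sup>+x. f (x + c) \<partial>\<mu>) = (\<integral>\<^sup>+x. f x \<partial>\<mu>)"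
    if [measurable]: "f \<in> borel_measurable borel" for f :: "'a \<Rightarrow> ennreal" and c
  proof -
    have "(\<integral>\<^sup>+x. f (x + c) \<partial>\<mu>) = (\<integral>\<^sup>+x. f (T x + c) \<partial>lborel)"
      by (simp add: \<mu>_def nn_integral_distr)
    also have "\<dots> = (\<integral>\<^sup>+x. f (T (S c + x)) \<partial>lborel)"
      using T S by (simp add: orthogonal_transformation_def linear_add add.commute)
    also have "\<dots> = (\<integral>\<^sup>+x. f (T x) \<partial>distr lborel borel ((+) (S c)))"
      by (simp add: nn_integral_distr)
    also have "\<dots> = (\<integral>\<^sup>+x. f x \<partial>\<mu>)"
      by (simp add: lborel_distr_plus \<mu>_def nn_integral_distr)
    finally show ?thesis .
  qed
  have translL: "(\<integral>\<^sup>+x. f (c + x) \<partial>lborel) = (\<integral>\<^sup>+x. f x \<partial>lborel)"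
    if [measurable]: "f \<in> borel_measurable borel" for f :: "'a \<Rightarrow> ennreal" and c
  proof -
    have "(\<integral>\<^sup>+x. f (c + x) \<partial>lborel) = (\<integral>\<^sup>+x. f x \<partial>distr lborel borel ((+) c))"
      by (simp add: nn_integral_distr)
    then show ?thesis by (simp add: lborel_distr_plus)
  qed
  have reflL: "(\<integral>\<^sup>+x. f (c - x) \<partial>lborel) = (\<integral>\<^sup>+x. f x \<partial>lborel)"
    if [measurable]: "f \<in> borel_measurable borel" for f :: "'a \<Rightarrow> ennreal" and c
  proof -
    have *: "lborel = density (distr lborel borel (\<lambda>x. c + (-1) *\<^sub>R x)) (\<lambda>_. \<bar>-1::real\<bar> ^ DIM('a))"
      by (rule lborel_affine) auto
    have "(\<integral>\<^sup>+x. f x \<partial>lborel) = (\<integral>\<^sup>+x. f x \<partial>distr lborel borel (\<lambda>x. c + (-1) *\<^sub>R x))"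
      by (subst *) (simp add: density_1)
    then show ?thesis by (simp add: nn_integral_distr)
  qed
  \<comment> \<open>The translated copy \<open>g (x + y)\<close> couples the two integrals: shifting
    \<open>y\<close> recovers the left product, while shifting \<open>x\<close> and then reflecting
    \<open>y\<close> exchanges the roles of \<open>f\<close> and \<open>g\<close>.\<close>
  have key: "(\<integral>\<^sup>+x. f x \<partial>\<mu>) * (\<integral>\<^sup>+x. g x \<partial>lborel) = (\<integral>\<^sup>+x. g x \<partial>\<mu>) * (\<integral>\<^sup>+x. f x \<partial>lborel)"
    if [measurable]: "f \<in> borel_measurable borel" "g \<in> borel_measurable borel"
    for f g :: "'a \<Rightarrow> ennreal"
  proof -
    have "(\<integral>\<^sup>+x. f x \<partial>\<mu>) * (\<integral>\<^sup>+x. g x \<partial>lborel) = (\<integral>\<^sup>+x. \<integral>\<^sup>+y. f x * g (x + y) \<partial>lborel \<partial>\<mu>)"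
      by (simp add: nn_integral_cmult nn_integral_multc translL)
    also have "\<dots> = (\<integral>\<^sup>+y. \<integral>\<^sup>+x. f x * g (x + y) \<partial>\<mu> \<partial>lborel)"
      by (rule P.Fubini'[symmetric]) measurable
    also have "\<dots> = (\<integral>\<^sup>+y. \<integral>\<^sup>+x. f (x - y) * g x \<partial>\<mu> \<partial>lborel)"
      using transl[of "\<lambda>x. f (x - y) * g x" y for y] by simp
    also have "\<dots> = (\<integral>\<^sup>+x. \<integral>\<^sup>+y. f (x - y) * g x \<partial>lborel \<partial>\<mu>)"
      by (rule P.Fubini') measurable
    also have "\<dots> = (\<integral>\<^sup>+x. g x \<partial>\<mu>) * (\<integral>\<^sup>+x. f x \<partial>lborel)"
      by (simp add: nn_integral_cmult nn_integral_multc reflL mult.commute)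
    finally show ?thesis .
  qed
  have "emeasure \<mu> A = emeasure lborel A" if [measurable]: "A \<in> sets borel" for A
  proof -
    let ?b = "emeasure lborel (ball 0 1 :: 'a set)"
    have "emeasure \<mu> A * ?b = ?b * emeasure lborel A"
      using key[OF borel_measurable_indicator borel_measurable_indicator, of A "ball 0 1"]
      by (simp add: ball)
    moreover have "?b \<noteq> 0" "?b \<noteq> \<infinity>"
      using emeasure_lborel_ball_finite[of "0::'a" 1] open_not_negligible[of "ball (0::'a) 1"]
      by (auto simp: negligible_iff_null_sets null_sets_def)
    ultimately show ?thesis
      by (metis ennreal_mult_cancel_left infinity_ennreal_def mult.commute)
  qed
  then show ?thesis
    unfolding \<mu>_def[symmetric] by (intro measure_eqI) auto
qed

lemma distr_gauss_isometry:
  fixes T :: "'a::euclidean_space \<Rightarrow> 'a"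
  assumes T: "orthogonal_transformation T"
  shows "distr gauss borel T = gauss"
proof -
  have [measurable]: "T \<in> borel_measurable borel"
    using T by (auto intro!: borel_measurable_continuous_onI linear_continuous_on
        simp: orthogonal_transformation_def linear_conv_bounded_linear)
  let ?f = "\<lambda>x::'a. ennreal (\<Prod>b\<in>Basis. std_normal_density (x \<bullet> b))"
  have *: "?f (T x) = ?f x" for x
    using T unfolding gauss_density_eq by (simp add: orthogonal_transformation)
  have "distr (density lborel (\<lambda>x. ?f (T x))) lborel T = density (distr lborel lborel T) ?f"
    by (rule density_distr[symmetric]) auto
  also have "distr lborel lborel T = lborel"
    by (subst (3) distr_lborel_isometry[OF T, symmetric], rule distr_cong) auto 
  finally have "distr (density lborel ?f) lborel T = density lborel ?f"
    by (simp only: *)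
  then show ?thesis
    unfolding gauss_def by (metis distr_cong sets_lborel)
qed

section \<open>Change of variables and Gaussian moments\<close>

text \<open>A simple function below \<open>f\<close> is measurable, so the usual change of variables
  applies to it, and its composition with \<open>T\<close> lies below \<open>f\<close> composed with
  \<open>T\<close>. The supremum over such functions gives the bound for arbitrary \<open>f\<close>,
  in this direction only.\<close>

lemma nn_integral_distr_le:
  assumes T: "T \<in> measurable M N"
  shows "(\<integral>\<^sup>+x. f x \<partial>distr M N T) \<le> (\<integral>\<^sup>+x. f (T x) \<partial>M)"
  unfolding nn_integral_def[of "distr M N T"]
proof (rule SUP_least, clarify)
  fix g assume g: "simple_function (distr M N T) g" "g \<le> f"
  have "integral\<^sup>S (distr M N T) g = (\<integral>\<^sup>+x. g x \<partial>distr M N T)"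
    using g by (simp add: nn_integral_eq_simple_integral)
  also have "\<dots> = (\<integral>\<^sup>+x. g (T x) \<partial>M)"
    using T borel_measurable_simple_function[OF g(1)] by (simp add: nn_integral_distr)
  also have "\<dots> \<le> (\<integral>\<^sup>+x. f (T x) \<partial>M)"
    using g(2) by (intro nn_integral_mono) (auto simp: le_fun_def)
  finally show "integral\<^sup>S (distr M N T) g \<le> (\<integral>\<^sup>+x. f (T x) \<partial>M)" .
qed

text \<open>The same argument, with Tonelli's theorem applied to each simple function below
  \<open>f\<close>.\<close>

lemma (in sigma_finite_measure) nn_integral_pair_le:
  "(\<integral>\<^sup>+z. f z \<partial>(N \<Otimes>\<^sub>M M)) \<le> (\<integral>\<^sup>+x. \<integral>\<^sup>+y. f (x, y) \<partial>M \<partial>N)"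
  unfolding nn_integral_def[of "N \<Otimes>\<^sub>M M"]
proof (rule SUP_least, clarify)
  fix g assume g: "simple_function (N \<Otimes>\<^sub>M M) g" "g \<le> f"
  have "integral\<^sup>S (N \<Otimes>\<^sub>M M) g = (\<integral>\<^sup>+z. g z \<partial>(N \<Otimes>\<^sub>M M))"
    using g by (simp add: nn_integral_eq_simple_integral)
  also have "\<dots> = (\<integral>\<^sup>+x. \<integral>\<^sup>+y. g (x, y) \<partial>M \<partial>N)"
    using borel_measurable_simple_function[OF g(1)] by (simp add: nn_integral_fst)
  also have "\<dots> \<le> (\<integral>\<^sup>+x. \<integral>\<^sup>+y. f (x, y) \<partial>M \<partial>N)"
    using g(2) by (intro nn_integral_mono) (auto simp: le_fun_def)
  finally show "integral\<^sup>S (N \<Otimes>\<^sub>M M) g \<le> (\<integral>\<^sup>+x. \<integral>\<^sup>+y. f (x, y) \<partial>M \<partial>N)" .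
qed

lemma linear_borel_measurable:
  fixes L :: "'a::euclidean_space \<Rightarrow> 'b::euclidean_space"
  shows "linear L \<Longrightarrow> L \<in> borel_measurable borel"
  by (intro borel_measurable_continuous_onI linear_continuous_on)
     (simp add: linear_conv_bounded_linear)

text \<open>\<open>L\<close> is an isometry on the orthogonal complement of its kernel. Adjoining an
  independent Gaussian vector in the target space extends it to an isometry \<open>T\<close> of the
  product space with first component \<open>L\<close>, so invariance under isometries carries
  over.\<close>

lemma distr_gauss_coisometry:
  fixes L :: "'a::euclidean_space \<Rightarrow> 'b::euclidean_space"
  assumes L: "linear L" and L': "linear L'"
    and adj: "\<And>x y. L x \<bullet> y = x \<bullet> L' y" and LL': "\<And>y. L (L' y) = y"
  shows "distr gauss borel L = gauss"
proof -
  note [measurable] = linear_borel_measurable[OF L]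
  \<comment> \<open>\<open>T\<close> exchanges the extra coordinate \<open>fst z\<close> with the
    component of \<open>snd z\<close> that \<open>L\<close> sees, and keeps the rest of
    \<open>snd z\<close>.\<close>
  define T where "T = (\<lambda>z :: 'b \<times> 'a. (L (snd z), snd z - L' (L (snd z)) + L' (fst z)))"
  have T: "orthogonal_transformation T"
    unfolding orthogonal_transformation
  proof safe
    interpret L: linear L by fact
    interpret L': linear L' by fact
    show "linear T"
      unfolding T_def
      by (intro linearI) (simp_all add: L.add L'.add L.scaleR L'.scaleR algebra_simps)
    fix y :: 'b and x :: 'a
    have 1: "(norm (x - L' (L x) + L' y))\<^sup>2 = (norm (x - L' (L x)))\<^sup>2 + (norm y)\<^sup>2"
    proof (subst norm_add_Pythagorean)
      show "orthogonal (x - L' (L x)) (L' y)"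
        by (simp add: orthogonal_def adj[symmetric] L.diff LL')
      have "L' y \<bullet> L' y = y \<bullet> y"
        by (simp add: adj[symmetric] LL')
      then show "(norm (x - L' (L x)))\<^sup>2 + (norm (L' y))\<^sup>2 = (norm (x - L' (L x)))\<^sup>2 + (norm y)\<^sup>2"
        by (simp add: power2_norm_eq_inner)
    qed
    have 2: "(norm x)\<^sup>2 = (norm (x - L' (L x)))\<^sup>2 + (norm (L x))\<^sup>2"
    proof -
      have "(norm (x - L' (L x) + L' (L x)))\<^sup>2 = (norm (x - L' (L x)))\<^sup>2 + (norm (L' (L x)))\<^sup>2"
        by (rule norm_add_Pythagorean) (simp add: orthogonal_def adj[symmetric] L.diff LL')
      moreover have "L' (L x) \<bullet> L' (L x) = L x \<bullet> L x"
        by (simp add: adj[symmetric] LL')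
      ultimately show ?thesis by (simp add: power2_norm_eq_inner)
    qed
    show "norm (T (y, x)) = norm (y, x)"
      using 1 2 by (simp add: T_def norm_Pair)
  qed
  have [measurable]: "T \<in> borel_measurable borel"
    using T by (intro linear_borel_measurable) (simp add: orthogonal_transformation_def)
  have [measurable]: "fst \<in> borel_measurable (borel :: ('b \<times> 'a) measure)"
      "snd \<in> borel_measurable (borel :: ('b \<times> 'a) measure)"
    by (auto intro!: borel_measurable_continuous_onI continuous_intros)
  have "emeasure (distr gauss borel L) A = emeasure gauss A" if [measurable]: "A \<in> sets borel" for A
  proof -
    have "emeasure (distr gauss borel L) A = emeasure (gauss :: 'b measure) UNIV * emeasure gauss (L -` A)"
      using gauss.emeasure_space_1[where 'a='b] by (simp add: emeasure_distr)
    also have "\<dots> = emeasure ((gauss :: 'b measure) \<Otimes>\<^sub>M gauss) (UNIV \<times> L -` A)"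
      using measurable_sets[OF linear_borel_measurable[OF L] that]
      by (subst gauss.emeasure_pair_measure_Times) auto
    also have "\<dots> = emeasure gauss ((\<lambda>z. fst (T z)) -` A)"
      by (simp add: gauss_Pair) (rule arg_cong2[where f=emeasure], auto simp: T_def)
    also have "\<dots> = emeasure (distr (distr gauss borel T) borel fst) A"
      by (subst distr_distr) (auto simp: emeasure_distr comp_def)
    also have "\<dots> = emeasure (distr (gauss \<Otimes>\<^sub>M gauss) gauss (fst :: 'b \<times> 'a \<Rightarrow> 'b)) A"
      unfolding distr_gauss_isometry[OF T] gauss_Pair
      by (rule arg_cong2[where f=emeasure]) (auto intro!: distr_cong)
    also have "\<dots> = emeasure gauss A"
      by (simp add: gauss.distr_pair_fst)
    finally show ?thesis .
  qed
  then show ?thesis by (intro measure_eqI) auto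
qed

text \<open>For an orthogonal projection \<open>P\<close> and independent Gaussian \<open>x\<close>,
  \<open>y\<close>, the vector \<open>P x + (y - P y)\<close> is again Gaussian, because the map
  from the pair is a coisometry with adjoint \<open>z\<close> to \<open>(P z, z - P z)\<close>. This
  is how the independence of the two components of a Gaussian vector is used throughout.\<close>

lemma nn_integral_gauss_split:
  fixes f :: "'a::euclidean_space \<Rightarrow> ennreal"
  assumes P: "linear P" and sym: "\<And>x y. P x \<bullet> y = x \<bullet> P y" and idem: "\<And>x. P (P x) = P x"
  shows "(\<integral>\<^sup>+x. f x \<partial>gauss) \<le> (\<integral>\<^sup>+x. \<integral>\<^sup>+y. f (P x + (y - P y)) \<partial>gauss \<partial>gauss)"
proof -
  interpret P: linear P by fact
  define L where "L = (\<lambda>z. P (fst z) + (snd z - P (snd z)))"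
  have lin: "linear L"
    unfolding L_def by (intro linearI) (simp_all add: P.add P.scaleR algebra_simps)
  have "distr gauss borel L = gauss"
  proof (rule distr_gauss_coisometry[OF lin, where L'="\<lambda>z. (P z, z - P z)"])
    show "linear (\<lambda>z. (P z, z - P z))"
      by (intro linearI) (simp_all add: P.add P.scaleR algebra_simps)
    show "L x \<bullet> y = x \<bullet> (P y, y - P y)" for x y
      by (simp add: L_def inner_prod_def inner_add_left inner_diff_left inner_diff_right sym)
    show "L (P y, y - P y) = y" for y
      by (simp add: L_def idem P.diff)
  qed
  then have "(\<integral>\<^sup>+x. f x \<partial>gauss) = (\<integral>\<^sup>+x. f x \<partial>distr gauss borel L)"
    by simp
  also have "\<dots> \<le> (\<integral>\<^sup>+z. f (L z) \<partial>(gauss \<Otimes>\<^sub>M gauss))"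
    unfolding gauss_Pair using linear_borel_measurable[OF lin] by (intro nn_integral_distr_le) simp
  also have "\<dots> \<le> (\<integral>\<^sup>+x. \<integral>\<^sup>+y. f (L (x, y)) \<partial>gauss \<partial>gauss)"
    by (rule gauss.nn_integral_pair_le)
  finally show ?thesis by (simp add: L_def)
qed

lemma distr_gauss_inner:
  fixes e :: "'a::euclidean_space"
  assumes "norm e = 1"
  shows "distr gauss borel (\<lambda>x. x \<bullet> e) = gauss"
proof (rule distr_gauss_coisometry[where L'="\<lambda>t. t *\<^sub>R e"])
  show "t *\<^sub>R e \<bullet> e = t" for t
    using assms by (simp add: norm_eq_1)
qed (auto intro!: linearI simp: inner_add_left algebra_simps)

lemma nn_integral_gauss_inner:
  assumes "norm e = 1" and [measurable]: "f \<in> borel_measurable borel"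
  shows "(\<integral>\<^sup>+x. f (x \<bullet> e) \<partial>gauss) = (\<integral>\<^sup>+t. ennreal (std_normal_density t) * f t \<partial>lborel)"
proof -
  have "(\<integral>\<^sup>+x. f (x \<bullet> e) \<partial>gauss) = (\<integral>\<^sup>+t. f t \<partial>distr gauss borel (\<lambda>x. x \<bullet> e))"
    by (simp add: nn_integral_distr)
  then show ?thesis
    by (simp add: distr_gauss_inner[OF assms(1)] gauss_real nn_integral_density)
qed

lemma nn_integral_gauss_inner_sq:
  fixes u :: "'a::euclidean_space"
  shows "(\<integral>\<^sup>+x. ennreal ((x \<bullet> u)\<^sup>2) \<partial>gauss) = ennreal ((norm u)\<^sup>2)"
proof (cases "u = 0")
  case False
  define e where "e = u /\<^sub>R norm u"
  have e: "norm e = 1" and u: "u = norm u *\<^sub>R e" using False by (auto simp: e_def)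
  have "(\<integral>\<^sup>+t. ennreal (std_normal_density t) * ennreal (t\<^sup>2) \<partial>lborel) = 1"
    using nn_integral_eq_integral[OF integrable_std_normal_moment[of 2]] integral_std_normal_moment_even[of 1]
    by (simp add: ennreal_mult[symmetric])
  then have 1: "(\<integral>\<^sup>+x. ennreal ((x \<bullet> e)\<^sup>2) \<partial>gauss) = 1"
    using nn_integral_gauss_inner[OF e, of "\<lambda>t. ennreal (t\<^sup>2)"] by simp
  have "(x \<bullet> u)\<^sup>2 = (norm u)\<^sup>2 * (x \<bullet> e)\<^sup>2" for x
    by (subst u) (simp add: power_mult_distrib)
  then show ?thesis
    by (simp add: ennreal_mult nn_integral_cmult 1)
qed simp

text \<open>The right side is the squared Hilbert-Schmidt norm of \<open>L\<close>. Each coordinate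
  of \<open>L x\<close> is an inner product of \<open>x\<close> with a vector of the adjoint, and
  the Hilbert-Schmidt norms of \<open>L\<close> and its adjoint agree.\<close>

lemma nn_integral_gauss_linear_sq:
  fixes L :: "'a::euclidean_space \<Rightarrow> 'b::euclidean_space"
  assumes L: "linear L"
  shows "(\<integral>\<^sup>+x. ennreal ((norm (L x))\<^sup>2) \<partial>gauss) = ennreal (\<Sum>b\<in>Basis. (norm (L b))\<^sup>2)"
proof -
  have "(norm (L x))\<^sup>2 = (\<Sum>c\<in>Basis. (x \<bullet> adjoint L c)\<^sup>2)" for x
    by (simp add: adjoint_works[OF L] power2_norm_eq_inner)
       (subst euclidean_inner, simp add: power2_eq_square)
  then have "(\<integral>\<^sup>+x. ennreal ((norm (L x))\<^sup>2) \<partial>gauss) =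
      (\<integral>\<^sup>+x. (\<Sum>c\<in>Basis. ennreal ((x \<bullet> adjoint L c)\<^sup>2)) \<partial>gauss)"
    by simp
  also have "\<dots> = (\<Sum>c\<in>Basis. ennreal ((norm (adjoint L c))\<^sup>2))"
    by (subst nn_integral_sum) (simp_all add: nn_integral_gauss_inner_sq)
  also have "\<dots> = ennreal (\<Sum>c\<in>Basis. \<Sum>b\<in>Basis. (adjoint L c \<bullet> b)\<^sup>2)"
    by (simp add: power2_norm_eq_inner)
       (subst euclidean_inner, simp add: power2_eq_square)
  also have "(\<Sum>c\<in>Basis. \<Sum>b\<in>Basis. (adjoint L c \<bullet> b)\<^sup>2) = (\<Sum>b\<in>Basis. \<Sum>c\<in>Basis. (L b \<bullet> c)\<^sup>2)"
    by (subst sum.swap) (simp add: adjoint_clauses[OF L] inner_commute)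
  also have "\<dots> = (\<Sum>b\<in>Basis. (norm (L b))\<^sup>2)"
    by (intro sum.cong refl, simp only: power2_norm_eq_inner, subst euclidean_inner)
       (simp add: power2_eq_square)
  finally show ?thesis .
qed

lemma nn_integral_gauss_exp_inner_sq:
  fixes e :: "'a::euclidean_space"
  assumes "norm e = 1" "t \<ge> 0"
  shows "(\<integral>\<^sup>+x. ennreal (exp (- t * (x \<bullet> e)\<^sup>2)) \<partial>gauss) = ennreal ((1 + 2 * t) powr (-1/2))"
proof -
  \<comment> \<open>Multiplying the standard density by \<open>exp (- t * x\<^sup>2)\<close> gives
    \<open>s\<close> times the normal density of standard deviation \<open>s\<close>, so the
    integral is \<open>s\<close>.\<close>
  define s where "s = 1 / sqrt (1 + 2 * t)"
  have s: "s > 0" "s\<^sup>2 = 1 / (1 + 2 * t)" "(1 + 2 * t) powr (-1/2) = s"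
    using assms by (auto simp: s_def powr_minus_divide powr_half_sqrt power_divide)
  have "std_normal_density x * exp (- t * x\<^sup>2) = s * normal_density 0 s x" for x
  proof -
    have "exp (- x\<^sup>2 / 2) * exp (- t * x\<^sup>2) = exp (- x\<^sup>2 / (2 * s\<^sup>2))"
    proof -
      have "1 + 2 * t \<noteq> 0" using assms(2) by simp
      then show ?thesis
        unfolding s(2) exp_add[symmetric] by (simp add: divide_simps) (simp add: algebra_simps)
    qed
    moreover have "sqrt (2 * pi * s\<^sup>2) = sqrt (2 * pi) * s"
      using s(1) by (simp add: real_sqrt_mult)
    ultimately show ?thesis
      using s(1) by (simp add: std_normal_density_def normal_density_def)
  qed
  then have "(\<integral>\<^sup>+x. ennreal (exp (- t * (x \<bullet> e)\<^sup>2)) \<partial>gauss) =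
      (\<integral>\<^sup>+x. ennreal s * ennreal (normal_density 0 s x) \<partial>lborel)"
    using s(1) by (subst nn_integral_gauss_inner[OF assms(1), of "\<lambda>x. ennreal (exp (- t * x\<^sup>2))"])
      (auto simp: ennreal_mult[symmetric])
  also have "\<dots> = ennreal s"
    using prob_space.emeasure_space_1[OF prob_space_normal_density[OF s(1), of 0]]
    by (simp add: emeasure_density nn_integral_cmult)
  finally show ?thesis by (simp only: s(3))
qed

text \<open>Induction on \<open>B\<close>: splitting along the new vector \<open>b\<close> gives it
  an independent copy of the Gaussian vector, and by orthogonality the other inner products see the
  second copy only. The Laplace transform thus factorizes.\<close>

lemma nn_integral_gauss_exp_sum_inner_sq:
  fixes B :: "'a::euclidean_space set"
  assumes "finite B" "pairwise orthogonal B" "\<And>b. b \<in> B \<Longrightarrow> norm b = 1" and t: "t \<ge> 0"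
  shows "(\<integral>\<^sup>+x. ennreal (exp (- t * (\<Sum>b\<in>B. (x \<bullet> b)\<^sup>2))) \<partial>gauss)
           \<le> ennreal ((1 + 2 * t) powr (- real (card B) / 2))"
  using assms(1-3)
proof (induction B rule: finite_induct)
  case empty
  then show ?case using t gauss.emeasure_space_1[where 'a='a] by simp
next
  case (insert b B)
  let ?g = "\<lambda>x. ennreal (exp (- t * (\<Sum>b\<in>B. (x \<bullet> b)\<^sup>2)))"
  have b: "b \<bullet> b = 1" using insert.prems by (auto simp: norm_eq_1)
  have orth: "b \<bullet> c = 0" if "c \<in> B" for c
    using insert.prems(1) insert.hyps that by (auto simp: pairwise_insert orthogonal_def)
  have "(\<integral>\<^sup>+x. ennreal (exp (- t * (\<Sum>b\<in>insert b B. (x \<bullet> b)\<^sup>2))) \<partial>gauss)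
     = (\<integral>\<^sup>+x. ennreal (exp (- t * (x \<bullet> b)\<^sup>2)) * ?g x \<partial>gauss)"
    using insert.hyps by (simp add: ennreal_mult[symmetric] exp_add[symmetric] algebra_simps)
  also have "\<dots> \<le> (\<integral>\<^sup>+x. \<integral>\<^sup>+y. (ennreal (exp (- t * (((x \<bullet> b) *\<^sub>R b + (y - (y \<bullet> b) *\<^sub>R b)) \<bullet> b)\<^sup>2)) *
        ?g ((x \<bullet> b) *\<^sub>R b + (y - (y \<bullet> b) *\<^sub>R b))) \<partial>gauss \<partial>gauss)"
    by (intro nn_integral_gauss_split[where P="\<lambda>x. (x \<bullet> b) *\<^sub>R b"] linearI)
       (auto simp: b inner_add_left inner_commute algebra_simps)
  also have "\<dots> = (\<integral>\<^sup>+x. \<integral>\<^sup>+y. ennreal (exp (- t * (x \<bullet> b)\<^sup>2)) * ?g y \<partial>gauss \<partial>gauss)"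
    by (intro nn_integral_cong arg_cong2[where f="(*)"] arg_cong[where f=ennreal] arg_cong[where f=exp]
          arg_cong[where f="(*) (-t)"] sum.cong)
       (auto simp: inner_add_left inner_diff_left b orth)
  also have "\<dots> = ennreal ((1 + 2 * t) powr (-1/2)) * (\<integral>\<^sup>+y. ?g y \<partial>gauss)"
    using insert.prems t
    by (simp add: nn_integral_cmult nn_integral_multc nn_integral_gauss_exp_inner_sq[simplified])
  also have "\<dots> \<le> ennreal ((1 + 2 * t) powr (-1/2)) * ennreal ((1 + 2 * t) powr (- real (card B) / 2))"
    using insert.prems by (intro mult_left_mono insert.IH) (auto simp: pairwise_insert)
  also have "\<dots> = ennreal ((1 + 2 * t) powr (- real (card (insert b B)) / 2))"
    using insert.hyps by (simp add: ennreal_mult[symmetric] powr_add[symmetric] diff_divide_distrib)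
  finally show ?case .
qed

section \<open>Inverse chi-square moments\<close>

text \<open>The condition \<open>d > 2\<close> makes the exponent \<open>1 - d / 2\<close> of the
  antiderivative negative, so that it vanishes at infinity.\<close>

lemma nn_integral_powr_tail:
  fixes d :: real
  assumes "d > 2"
  shows "(\<integral>\<^sup>+t. ennreal ((1 + 2 * t) powr (- d / 2)) * indicator {0..} t \<partial>lborel) = ennreal (1 / (d - 2))"
proof -
  let ?F = "\<lambda>t::real. - ((1 + 2 * t) powr (1 - d / 2)) / (d - 2)"
  have "(\<integral>\<^sup>+t. ennreal ((1 + 2 * t) powr (- d / 2)) * indicator {0..} t \<partial>lborel) = 0 - ?F 0"
  proof (rule nn_integral_FTC_atLeast)
    fix x :: real assume x: "0 \<le> x"
    have "DERIV (\<lambda>t. (1 + 2 * t) powr (1 - d / 2)) x :> (1 - d / 2) * (1 + 2 * x) powr (1 - d / 2 - 1) * 2"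
      using x by (auto intro!: derivative_eq_intros)
    then have "DERIV ?F x :> - ((1 - d / 2) * (1 + 2 * x) powr (1 - d / 2 - 1) * 2) / (d - 2)"
      using assms by (intro DERIV_cdivide DERIV_minus) auto
    moreover have "- ((1 - d / 2) * (1 + 2 * x) powr (1 - d / 2 - 1) * 2) / (d - 2) = (1 + 2 * x) powr (- d / 2)"
      using assms by (simp add: divide_simps) (simp add: algebra_simps)
    ultimately show "DERIV ?F x :> (1 + 2 * x) powr (- d / 2)"
      by simp
    show "0 \<le> (1 + 2 * x) powr (- d / 2)" by simp
  next
    have "((\<lambda>t::real. (1 + 2 * t) powr (1 - d / 2)) \<longlongrightarrow> 0) at_top"
      using assms
      by (intro tendsto_neg_powr filterlim_tendsto_add_at_top[OF tendsto_const]
            filterlim_tendsto_pos_mult_at_top[OF tendsto_const] filterlim_ident) auto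
    then have "(?F \<longlongrightarrow> - 0 / (d - 2)) at_top"
      by (intro tendsto_intros) (use assms in auto)
    then show "(?F \<longlongrightarrow> 0) at_top" by simp
  qed auto
  then show ?thesis by simp
qed

lemma nn_integral_exp_tail:
  fixes s :: real
  assumes "s \<ge> 0"
  shows "(\<integral>\<^sup>+t. ennreal (exp (- t * s)) * indicator {0..} t \<partial>lborel) = inverse (ennreal s)"
proof (cases "s = 0")
  case True
  \<comment> \<open>At \<open>s = 0\<close> the integrand is 1 on a half-line of infinite measure,
    which matches \<open>inverse 0 = \<infinity>\<close> in the extended reals.\<close>
  have "of_nat n \<le> emeasure lborel {0::real..}" for n
    using emeasure_mono[of "{0..real n}" "{0..}" lborel] by (simp add: ennreal_of_nat_eq_real_of_nat)
  then have "emeasure lborel {0::real..} = \<infinity>"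
    by (metis ennreal_Ex_less_of_nat infinity_ennreal_def leD less_top)
  then show ?thesis using True by (simp add: nn_integral_indicator)
next
  case False
  then have s: "s > 0" using assms by simp
  have "(\<integral>\<^sup>+t. ennreal (exp (- t * s)) * indicator {0..} t \<partial>lborel) = 0 - (- exp (- 0 * s) / s)"
  proof (rule nn_integral_FTC_atLeast)
    show "DERIV (\<lambda>t. - exp (- t * s) / s) x :> exp (- x * s)" for x
      using s by (auto intro!: derivative_eq_intros)
    have "((\<lambda>t. exp (- (t * s))) \<longlongrightarrow> 0) at_top"
      using s by (intro filterlim_compose[OF exp_at_bot] filterlim_uminus_at_bot_at_top[THEN filterlim_compose]
           filterlim_at_top_mult_tendsto_pos[OF tendsto_const] filterlim_ident)
    then have "((\<lambda>t. - exp (- (t * s)) / s) \<longlongrightarrow> - 0 / s) at_top"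
      using s by (intro tendsto_intros) auto
    then show "((\<lambda>t. - exp (- t * s) / s) \<longlongrightarrow> 0) at_top"
      by simp
  qed auto
  then show ?thesis using s by (simp add: inverse_ennreal divide_inverse)
qed

text \<open>Writing \<open>1/s\<close> as the integral of \<open>exp (- t s)\<close> reduces the mean of an inverse chi-square
  variable to its Laplace transform. The value \<open>\<infinity>\<close> at \<open>s = 0\<close> makes positivity
  almost everywhere a consequence of the finite mean.\<close>

lemma nn_integral_gauss_inverse_sum_inner_sq:
  fixes B :: "'a::euclidean_space set"
  assumes B: "finite B" "pairwise orthogonal B" "\<And>b. b \<in> B \<Longrightarrow> norm b = 1" and "card B > 2"
  shows "(\<integral>\<^sup>+x. inverse (ennreal (\<Sum>b\<in>B. (x \<bullet> b)\<^sup>2)) \<partial>gauss) \<le> ennreal (1 / (real (card B) - 2))"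
proof -
  interpret P: pair_sigma_finite "gauss :: 'a measure" "lborel :: real measure"
    by (intro pair_sigma_finite.intro gauss.sigma_finite_measure_axioms sigma_finite_lborel)
  have "(\<integral>\<^sup>+x. inverse (ennreal (\<Sum>b\<in>B. (x \<bullet> b)\<^sup>2)) \<partial>gauss) =
      (\<integral>\<^sup>+x. \<integral>\<^sup>+t. ennreal (exp (- t * (\<Sum>b\<in>B. (x \<bullet> b)\<^sup>2))) * indicator {0..} t \<partial>lborel \<partial>gauss)"
    by (intro nn_integral_cong nn_integral_exp_tail[symmetric] sum_nonneg) auto
  also have "\<dots> = (\<integral>\<^sup>+t. \<integral>\<^sup>+x. ennreal (exp (- t * (\<Sum>b\<in>B. (x \<bullet> b)\<^sup>2))) * indicator {0..} t \<partial>gauss \<partial>lborel)"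
    by (rule P.Fubini'[symmetric]) measurable
  also have "\<dots> \<le> (\<integral>\<^sup>+t. ennreal ((1 + 2 * t) powr (- real (card B) / 2)) * indicator {0..} t \<partial>lborel)"
  proof (intro nn_integral_mono)
    fix t :: real
    show "(\<integral>\<^sup>+x. ennreal (exp (- t * (\<Sum>b\<in>B. (x \<bullet> b)\<^sup>2))) * indicator {0..} t \<partial>gauss)
        \<le> ennreal ((1 + 2 * t) powr (- real (card B) / 2)) * indicator {0..} t"
      using nn_integral_gauss_exp_sum_inner_sq[OF B, of t] by (cases "t \<ge> 0") auto
  qed
  also have "\<dots> = ennreal (1 / (real (card B) - 2))"
    using assms by (intro nn_integral_powr_tail) auto
  finally show ?thesis .
qed

text \<open>Bessel's inequality, read off the squared norm of \<open>x - p\<close>, where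
  \<open>p\<close> is the projection of \<open>x\<close> onto the span of \<open>B\<close>.\<close>

lemma sum_inner_sq_le_norm_sq:
  fixes B :: "'a::euclidean_space set"
  assumes B: "finite B" "pairwise orthogonal B" "\<And>b. b \<in> B \<Longrightarrow> norm b = 1"
  shows "(\<Sum>b\<in>B. (x \<bullet> b)\<^sup>2) \<le> (norm x)\<^sup>2"
proof -
  define p where "p = (\<Sum>b\<in>B. (x \<bullet> b) *\<^sub>R b)"
  have 1: "(norm p)\<^sup>2 = (\<Sum>b\<in>B. (x \<bullet> b)\<^sup>2)"
    unfolding p_def
    using B by (subst norm_sum_Pythagorean)
      (auto simp: pairwise_def orthogonal_def power_mult_distrib)
  have "x \<bullet> p = (\<Sum>b\<in>B. (x \<bullet> b)\<^sup>2)"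
    by (simp add: p_def inner_sum_right power2_eq_square)
  then have "(norm (x - p))\<^sup>2 = (norm x)\<^sup>2 - (\<Sum>b\<in>B. (x \<bullet> b)\<^sup>2)"
    using 1 by (simp add: power2_norm_eq_inner inner_diff_left inner_diff_right inner_commute)
  then show ?thesis
    by (metis diff_ge_0_iff_ge zero_le_power2)
qed

lemma inverse_ennreal_antimono:
  assumes "0 \<le> a" "a \<le> b"
  shows "inverse (ennreal b) \<le> inverse (ennreal a)"
  using assms by (cases "a = 0") (auto simp: inverse_ennreal intro!: ennreal_leI le_imp_inverse_le)

text \<open>The distance from \<open>V\<close> is at least the length of the projection onto the
  orthogonal complement of \<open>V\<close>, whose square is chi-square distributed. Here
  \<open>d\<close> is only a lower bound for the codimension, since the dimension of a span is only
  bounded from above.\<close>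

lemma nn_integral_gauss_inverse_infdist:
  fixes V :: "'a::euclidean_space set"
  assumes V: "subspace V" and d: "d + dim V \<le> DIM('a)" "d > 2"
  shows "(\<integral>\<^sup>+x. inverse (ennreal ((infdist x V)\<^sup>2)) \<partial>gauss) \<le> ennreal (1 / (real d - 2))"
proof -
  let ?W = "{y. \<forall>x\<in>V. orthogonal x y}"
  have W: "subspace ?W"
    by (auto simp: subspace_def orthogonal_def inner_add_right)
  obtain B where B: "B \<subseteq> ?W" "pairwise orthogonal B" "\<And>x. x \<in> B \<Longrightarrow> norm x = 1"
      "independent B" "card B = dim ?W" "span B = ?W"
    by (rule orthonormal_basis_subspace[OF W]) (rule that)
  have fin: "finite B" using B(4) by (rule independent_imp_finite)
  have "dim ?W + dim V = DIM('a)"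
    using dim_subspace_orthogonal_to_vectors[OF V subspace_UNIV] by simp
  with d B(5) have card: "d \<le> card B" "card B > 2" by auto
  have "(\<Sum>b\<in>B. (x \<bullet> b)\<^sup>2) \<le> (infdist x V)\<^sup>2" for x
  proof -
    have V0: "V \<noteq> {}" using subspace_0[OF V] by auto
    have "sqrt (\<Sum>b\<in>B. (x \<bullet> b)\<^sup>2) \<le> infdist x V"
      unfolding infdist_notempty[OF V0]
    proof (rule cINF_greatest[OF V0])
      fix v assume v: "v \<in> V"
      have "(\<Sum>b\<in>B. (x \<bullet> b)\<^sup>2) = (\<Sum>b\<in>B. ((x - v) \<bullet> b)\<^sup>2)"
        using B(1) v by (intro sum.cong) (auto simp: inner_diff_left orthogonal_def)
      also have "\<dots> \<le> (norm (x - v))\<^sup>2"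
        by (rule sum_inner_sq_le_norm_sq[OF fin B(2,3)])
      finally show "sqrt (\<Sum>b\<in>B. (x \<bullet> b)\<^sup>2) \<le> dist x v"
        by (simp add: dist_norm real_le_lsqrt)
    qed
    then have "(sqrt (\<Sum>b\<in>B. (x \<bullet> b)\<^sup>2))\<^sup>2 \<le> (infdist x V)\<^sup>2"
      by (intro power_mono) (auto intro!: sum_nonneg)
    then show ?thesis
      by (simp add: sum_nonneg)
  qed
  then have "(\<integral>\<^sup>+x. inverse (ennreal ((infdist x V)\<^sup>2)) \<partial>gauss)
      \<le> (\<integral>\<^sup>+x. inverse (ennreal (\<Sum>b\<in>B. (x \<bullet> b)\<^sup>2)) \<partial>gauss)"
    by (intro nn_integral_mono inverse_ennreal_antimono sum_nonneg) auto
  also have "\<dots> \<le> ennreal (1 / (real (card B) - 2))"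
    using fin B card by (intro nn_integral_gauss_inverse_sum_inner_sq) auto
  also have "\<dots> \<le> ennreal (1 / (real d - 2))"
    using card d by (intro ennreal_leI divide_left_mono) auto
  finally show ?thesis .
qed

section \<open>The Gaussian measure as an image of a product measure\<close>

lemma density_PiM:
  fixes f :: "'b \<Rightarrow> ennreal"
  assumes I: "finite I" and M: "sigma_finite_measure M" "sigma_finite_measure (density M f)"
    and f [measurable]: "f \<in> borel_measurable M"
  shows "density (Pi\<^sub>M I (\<lambda>_. M)) (\<lambda>x. \<Prod>i\<in>I. f (x i)) = Pi\<^sub>M I (\<lambda>_. density M f)"
proof -
  interpret M: product_sigma_finite "\<lambda>_. M" using M by (simp add: product_sigma_finite_def)
  interpret D: product_sigma_finite "\<lambda>_. density M f" using M by (simp add: product_sigma_finite_def)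
  show ?thesis
  proof (rule D.PiM_eqI[OF I])
    show "sets (density (Pi\<^sub>M I (\<lambda>_. M)) (\<lambda>x. \<Prod>i\<in>I. f (x i))) = Pi\<^sub>M I (\<lambda>_. density M f)"
      by (simp cong: sets_PiM_cong)
    fix A assume A: "\<And>i. i \<in> I \<Longrightarrow> A i \<in> sets (density M f)"
    then have [measurable]: "\<And>i. i \<in> I \<Longrightarrow> A i \<in> sets M" by simp
    have "Pi\<^sub>E I A \<in> sets (Pi\<^sub>M I (\<lambda>_. M))"
      using I by (intro sets_PiM_I_finite) auto
    moreover have "(\<lambda>x. \<Prod>i\<in>I. f (x i)) \<in> borel_measurable (Pi\<^sub>M I (\<lambda>_. M))"
      by measurable
    ultimately have "emeasure (density (Pi\<^sub>M I (\<lambda>_. M)) (\<lambda>x. \<Prod>i\<in>I. f (x i))) (Pi\<^sub>E I A) =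
        (\<integral>\<^sup>+x. (\<Prod>i\<in>I. f (x i)) * indicator (Pi\<^sub>E I A) x \<partial>Pi\<^sub>M I (\<lambda>_. M))"
      by (intro emeasure_density)
    also have "\<dots> = (\<integral>\<^sup>+x. (\<Prod>i\<in>I. f (x i) * indicator (A i) (x i)) \<partial>Pi\<^sub>M I (\<lambda>_. M))"
    proof (intro nn_integral_cong)
      fix x assume "x \<in> space (Pi\<^sub>M I (\<lambda>_. M))"
      then have "indicator (Pi\<^sub>E I A) x = (\<Prod>i\<in>I. indicator (A i) (x i) :: ennreal)"
        using I by (auto simp: indicator_def space_PiM PiE_iff prod_eq_1_iff)
      then show "(\<Prod>i\<in>I. f (x i)) * indicator (Pi\<^sub>E I A) x = (\<Prod>i\<in>I. f (x i) * indicator (A i) (x i))"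
        by (simp add: prod.distrib)
    qed
    also have "\<dots> = (\<Prod>i\<in>I. \<integral>\<^sup>+x. f x * indicator (A i) x \<partial>M)"
      by (rule M.product_nn_integral_prod[OF I]) measurable
    also have "\<dots> = (\<Prod>i\<in>I. emeasure (density M f) (A i))"
      by (intro prod.cong refl emeasure_density[symmetric]) auto
    finally show "emeasure (density (Pi\<^sub>M I (\<lambda>_. M)) (\<lambda>x. \<Prod>i\<in>I. f (x i))) (Pi\<^sub>E I A) =
        (\<Prod>i\<in>I. emeasure (density M f) (A i))" .
  qed
qed

text \<open>Lebesgue measure is the image of a product measure under the same map, and the density
  factorizes over coordinates. In this form \<open>gauss\<close> can be compared with the joint law
  of independent entries.\<close>

lemma gauss_eq_distr_PiM:
  "(gauss :: 'a::euclidean_space measure) =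
     distr (\<Pi>\<^sub>M b\<in>(Basis :: 'a set). (gauss :: real measure)) borel (\<lambda>f. \<Sum>b\<in>Basis. f b *\<^sub>R b)"
proof -
  let ?S = "\<lambda>f :: 'a \<Rightarrow> real. \<Sum>b\<in>Basis. f b *\<^sub>R b"
  let ?f = "\<lambda>x::'a. ennreal (\<Prod>b\<in>Basis. std_normal_density (x \<bullet> b))"
  let ?N = "\<Pi>\<^sub>M b\<in>(Basis :: 'a set). (lborel :: real measure)"
  have "density ?N (\<lambda>x. ?f (?S x)) = density ?N (\<lambda>x. \<Prod>b\<in>Basis. ennreal (std_normal_density (x b)))"
    by (intro arg_cong[where f="density _"] ext) (simp add: prod_ennreal)
  also have "\<dots> = (\<Pi>\<^sub>M b\<in>(Basis :: 'a set). (gauss :: real measure))"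
    unfolding gauss_real
    using gauss.sigma_finite_measure_axioms[where 'a=real] sigma_finite_lborel
    by (intro density_PiM) (auto simp: gauss_real)
  finally have *: "density ?N (\<lambda>x. ?f (?S x)) = (\<Pi>\<^sub>M b\<in>(Basis :: 'a set). (gauss :: real measure))" .
  have "(gauss :: 'a measure) = density (distr ?N borel ?S) ?f"
    unfolding gauss_def by (subst (1) lborel_eq) simp
  also have "\<dots> = distr (density ?N (\<lambda>x. ?f (?S x))) borel ?S"
    by (rule density_distr) auto
  finally show ?thesis unfolding * .
qed

section \<open>Matrices over real or complex scalars\<close>

lemma rc_conjugate_one [simp]: "conjugate (1 :: 'f::rc_field) = 1"
proof -
  have "conjugate (1::'f) * conjugate 1 = conjugate 1 * 1"
    by (metis conjugate_dist_mul mult_1_right)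
  moreover have "conjugate (1::'f) \<noteq> 0" by simp
  ultimately show ?thesis
    using mult_left_cancel[of "conjugate 1" "conjugate 1" "1::'f"] by blast
qed

lemma rc_conjugate_diff: "conjugate (x - y) = conjugate x - conjugate (y :: 'f::rc_field)"
  using conjugate_dist_add[of x "- y"] by (simp add: conjugate_neg)

text \<open>Conjugation is assumed additive and multiplicative; it fixes real scalars because
  \<open>conjugate_mult_self\<close> at \<open>c *\<^sub>R 1\<close> allows cancelling
  \<open>c\<close> when \<open>c\<close> is nonzero.\<close>

lemma rc_conjugate_scaleR: "conjugate (c *\<^sub>R x) = c *\<^sub>R conjugate (x :: 'f::rc_field)"
proof -
  have "conjugate (c *\<^sub>R (1::'f)) = c *\<^sub>R 1"
  proof (cases "c = 0")
    case False
    have "conjugate (c *\<^sub>R (1::'f)) * (c *\<^sub>R 1) = (c *\<^sub>R 1) * (c *\<^sub>R 1)"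
      by (simp only: conjugate_mult_self) (simp add: power2_eq_square)
    then show ?thesis
      using False mult_right_cancel[of "c *\<^sub>R (1::'f)" "conjugate (c *\<^sub>R 1)" "c *\<^sub>R 1"] by simp
  qed simp
  then have "conjugate ((c *\<^sub>R 1) * x) = (c *\<^sub>R 1) * conjugate x"
    by (simp only: conjugate_dist_mul)
  then show ?thesis by simp
qed

lemma rc_norm_conjugate [simp]: "norm (conjugate (x :: 'f::rc_field)) = norm x"
proof -
  have "(norm (conjugate x))\<^sup>2 *\<^sub>R (1::'f) = (norm x)\<^sup>2 *\<^sub>R 1"
    using conjugate_mult_self[of x] conjugate_mult_self[of "conjugate x"] by (simp add: mult.commute)
  then show ?thesis by (simp add: power2_eq_iff_nonneg)
qed

lemma rc_inner_conjugate: "inner (conjugate x) (conjugate y) = inner x (y :: 'f::rc_field)"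
  unfolding dot_norm conjugate_dist_add[symmetric] rc_norm_conjugate ..

lemma rc_inner_mult_left: "inner (a * b) c = inner b (conjugate a * (c :: 'f::rc_field))"
  unfolding inner_eq_inner_one[of "a * b" c] inner_eq_inner_one[of b "conjugate a * c"]
  by (simp add: conjugate_dist_mul mult_ac)

section \<open>Hermitian products, rank-one matrices and adjoints\<close>

definition hdot :: "'f::rc_field^'n \<Rightarrow> 'f^'n \<Rightarrow> 'f" where
  "hdot x y = (\<Sum>i\<in>UNIV. conjugate (x $ i) * y $ i)"

definition outer :: "'f::rc_field^'m \<Rightarrow> 'f^'n \<Rightarrow> 'f^'n^'m" where
  "outer x y = (\<chi> a b. x $ a * conjugate (y $ b))"

lemma hdot_self: "hdot x x = (norm x)\<^sup>2 *\<^sub>R (1 :: 'f::rc_field)"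
  by (simp add: hdot_def conjugate_mult_self norm_vec_def L2_set_def sum_nonneg scaleR_sum_left)

lemma hdot_commute: "hdot y x = conjugate (hdot x y)"
  by (simp add: hdot_def sum_conjugate conjugate_dist_mul mult.commute)

lemma hdot_add_right: "hdot x (y + z) = hdot x y + hdot x z"
  and hdot_scaleR_left: "hdot (r *\<^sub>R x) y = r *\<^sub>R hdot x y"
  by (simp_all add: hdot_def algebra_simps sum.distrib sum_distrib_left rc_conjugate_scaleR scaleR_sum_right)

lemma inner_scale_right: "inner x (c *s y) = inner 1 (c * hdot x y)" for c :: "'f::rc_field"
proof -
  have "inner x (c *s y) = (\<Sum>i\<in>UNIV. inner 1 (conjugate (x $ i) * (c * y $ i)))"
    unfolding inner_vec_def by (subst inner_eq_inner_one) simp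
  then show ?thesis
    by (simp add: hdot_def inner_sum_right sum_distrib_left mult_ac)
qed

text \<open>Real orthogonality to all scalar multiples of \<open>y\<close> is Hermitian
  orthogonality: the choice \<open>c = conjugate (hdot x y)\<close> gives the squared norm of
  \<open>hdot x y\<close>. This transfers real projection theorems to spans over
  \<open>'f\<close>.\<close>

lemma hdot_eq_0I:
  assumes "\<And>c. inner x (c *s y) = 0"
  shows "hdot x y = (0 :: 'f::rc_field)"
proof -
  have "inner 1 (conjugate (hdot x y) * hdot x y) = 0"
    using assms[of "conjugate (hdot x y)"] by (simp add: inner_scale_right)
  then show ?thesis by (simp add: conjugate_mult_self)
qed

lemma conj_transpose_nth [simp]: "conj_transpose A $ i $ j = conjugate (A $ j $ i)"
  by (simp add: conj_transpose_def)

lemma conj_transpose_conj_transpose [simp]: "conj_transpose (conj_transpose A) = A"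
  by (simp add: vec_eq_iff)

lemma conj_transpose_mult:
  "conj_transpose (A ** B) = conj_transpose B ** conj_transpose (A :: 'f::rc_field^_^_)"
  by (simp add: vec_eq_iff matrix_matrix_mult_def sum_conjugate conjugate_dist_mul mult.commute)

lemma conj_transpose_add: "conj_transpose (A + B) = conj_transpose A + conj_transpose (B :: 'f::rc_field^_^_)"
  and conj_transpose_diff: "conj_transpose (A - B) = conj_transpose A - conj_transpose (B :: 'f::rc_field^_^_)"
  and conj_transpose_scaleR: "conj_transpose (c *\<^sub>R A) = c *\<^sub>R conj_transpose (A :: 'f::rc_field^_^_)"
  and conj_transpose_zero [simp]: "conj_transpose (0 :: 'f::rc_field^_^_) = 0"
  by (simp_all add: vec_eq_iff conjugate_dist_add rc_conjugate_diff rc_conjugate_scaleR)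

lemma conj_transpose_sum: "conj_transpose (\<Sum>i\<in>I. f i) = (\<Sum>i\<in>I. conj_transpose (f i :: 'f::rc_field^_^_))"
  by (induction I rule: infinite_finite_induct) (auto simp: conj_transpose_add)

lemma conj_transpose_mat_1 [simp]: "conj_transpose (mat 1) = (mat 1 :: 'f::rc_field^'n^'n)"
  by (simp add: vec_eq_iff mat_def)

lemma linear_conj_transpose: "linear (conj_transpose :: 'f::rc_field^'n^'m \<Rightarrow> _)"
  by (intro linearI) (simp_all add: conj_transpose_add conj_transpose_scaleR)

lemma inner_conj_transpose: "inner (conj_transpose A) B = inner A (conj_transpose (B :: 'f::rc_field^_^_))"
proof -
  have "inner (conjugate x) y = inner x (conjugate y)" for x y :: 'f
    using rc_inner_conjugate[of x "conjugate y"] by simp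
  then show ?thesis
    by (simp add: inner_vec_def) (rule sum.swap)
qed

lemma norm_conj_transpose [simp]: "norm (conj_transpose A) = norm (A :: 'f::rc_field^_^_)"
  by (simp add: norm_eq_sqrt_inner inner_conj_transpose)

lemma inner_matrix_vector_left:
  "inner (A *v x) y = inner x (conj_transpose A *v (y :: 'f::rc_field^_))"
proof -
  have "inner (A *v x) y = (\<Sum>i\<in>UNIV. \<Sum>j\<in>UNIV. inner (x $ j) (conjugate (A $ i $ j) * y $ i))"
    by (simp add: inner_vec_def matrix_vector_mult_def inner_sum_left rc_inner_mult_left)
  also have "\<dots> = inner x (conj_transpose A *v y)"
    by (subst sum.swap) (simp add: inner_vec_def matrix_vector_mult_def inner_sum_right)
  finally show ?thesis .
qed

lemma column_mult: "column j (A ** B) = A *v column j (B :: 'f::field^_^_)"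
  by (simp add: vec_eq_iff column_def matrix_matrix_mult_def matrix_vector_mult_def)

lemma inner_eq_sum_columns: "inner A B = (\<Sum>j\<in>UNIV. inner (column j A) (column j (B :: 'f::rc_field^_^_)))"
  unfolding inner_vec_def[of A] inner_vec_def[of "_ $ _"]
  by (subst sum.swap) (simp add: inner_vec_def column_def)

lemma inner_matrix_mult_left: "inner (A ** X) Y = inner X (conj_transpose A ** (Y :: 'f::rc_field^_^_))"
  by (simp add: inner_eq_sum_columns column_mult inner_matrix_vector_left)

lemma inner_matrix_mult_right: "inner (X ** A) Y = inner X (Y ** conj_transpose (A :: 'f::rc_field^_^_))"
proof -
  have "inner (X ** A) Y = inner (conj_transpose A ** conj_transpose X) (conj_transpose Y)"
    by (metis conj_transpose_conj_transpose conj_transpose_mult inner_conj_transpose)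
  also have "\<dots> = inner X (Y ** conj_transpose A)"
    by (simp add: inner_matrix_mult_left inner_conj_transpose conj_transpose_mult)
  finally show ?thesis .
qed

lemma matrix_mult_diff_left: "A ** (B - C) = A ** B - A ** (C :: 'f::ring_1^_^_)"
  and matrix_mult_diff_right: "(B - C) ** D = B ** D - C ** (D :: 'f::ring_1^_^_)"
  and matrix_mult_add_left: "A ** (B + C) = A ** B + A ** (C :: 'f::ring_1^_^_)"
  and matrix_mult_add_right: "(B + C) ** D = B ** D + C ** (D :: 'f::ring_1^_^_)"
  and matrix_mult_zero_left [simp]: "0 ** D = (0 :: 'f::ring_1^_^_)"
  and matrix_mult_zero_right [simp]: "A ** 0 = (0 :: 'f::ring_1^_^_)"
  by (simp_all add: vec_eq_iff matrix_matrix_mult_def algebra_simps sum.distrib sum_subtractf)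

lemma matrix_mult_sum_left: "A ** (\<Sum>i\<in>I. f i) = (\<Sum>i\<in>I. A ** (f i :: 'f::ring_1^_^_))"
  and matrix_mult_sum_right: "(\<Sum>i\<in>I. f i) ** D = (\<Sum>i\<in>I. f i ** (D :: 'f::ring_1^_^_))"
  by (induction I rule: infinite_finite_induct; simp add: matrix_mult_add_left matrix_mult_add_right)+

lemma matrix_mult_scaleR_left: "A ** (c *\<^sub>R B) = c *\<^sub>R (A ** (B :: 'f::rc_field^_^_))"
  and matrix_mult_scaleR_right: "(c *\<^sub>R A) ** B = c *\<^sub>R (A ** (B :: 'f::rc_field^_^_))"
  by (simp_all add: vec_eq_iff matrix_matrix_mult_def scaleR_sum_right)

lemma matrix_mult_outer: "A ** outer x y = outer (A *v x) (y :: 'f::rc_field^_)"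
  by (simp add: vec_eq_iff outer_def matrix_matrix_mult_def matrix_vector_mult_def sum_distrib_right mult.assoc)

lemma conj_transpose_outer: "conj_transpose (outer x y) = outer y (x :: 'f::rc_field^_)"
  by (simp add: vec_eq_iff outer_def conjugate_dist_mul mult.commute)

lemma outer_matrix_mult: "outer x y ** A = outer x (conj_transpose A *v (y :: 'f::rc_field^_))"
  by (metis conj_transpose_conj_transpose conj_transpose_mult conj_transpose_outer matrix_mult_outer)

lemma outer_mult_vector: "outer x y *v z = hdot y z *s (x :: 'f::rc_field^_)"
  by (simp add: vec_eq_iff outer_def matrix_vector_mult_def hdot_def sum_distrib_right sum_distrib_left mult_ac)

lemma outer_zero_left [simp]: "outer 0 y = 0"
  by (simp add: vec_eq_iff outer_def)

lemma norm_outer: "norm (outer x y) = norm x * norm (y :: 'f::rc_field^_)"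
proof -
  have "(norm (outer x y))\<^sup>2 = (norm x * norm y)\<^sup>2"
    by (simp add: norm_matrix_eq_frobenius outer_def norm_mult power_mult_distrib
        norm_vec_def L2_set_def sum_nonneg sum_product)
  then show ?thesis by (simp add: power2_eq_iff_nonneg)
qed

lemma orthogonal_outer:
  assumes "hdot y z = 0"
  shows "orthogonal (outer x y) (outer w (z :: 'f::rc_field^_))"
proof -
  have "inner (outer x y) (outer w z) = inner (outer x y ** outer z w) (mat 1)"
    by (simp add: inner_matrix_mult_right conj_transpose_outer)
  then show ?thesis
    using assms by (simp add: matrix_mult_outer outer_mult_vector orthogonal_def)
qed

lemma sum_Basis_vec: "(\<Sum>b\<in>(Basis :: ('a::euclidean_space^'n) set). f b) = (\<Sum>i\<in>UNIV. \<Sum>u\<in>Basis. f (axis i u))"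
  unfolding Basis_vec_def
  by (subst sum.UNION_disjoint)
     (auto simp: axis_eq_axis UNION_singleton_eq_range inj_on_def intro!: sum.cong sum.reindex_cong)

text \<open>The squared Hilbert-Schmidt norm of the map sending \<open>X\<close> to
  \<open>B ** X ** T\<close>. A basis matrix with single entry \<open>u\<close> gives the entries
  \<open>B $ a $ i * u * T $ j $ c\<close>, and each position carries \<open>DIM('f)\<close> unit
  values of \<open>u\<close>.\<close>

lemma sum_Basis_norm_sq:
  fixes B :: "'f::rc_field^'n^'m" and T :: "'f^'q^'p"
  shows "(\<Sum>b\<in>(Basis :: ('f^'p^'n) set). (norm (B ** b ** T))\<^sup>2) = DIM('f) * (norm B)\<^sup>2 * (norm T)\<^sup>2"
proof -
  have entry: "(B ** axis i (axis j u) ** T) $ a $ c = B $ a $ i * u * T $ j $ c" for i j a c u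
  proof -
    have "(B ** axis i (axis j u)) $ a $ p = (if p = j then B $ a $ i * u else 0)" for p
      by (simp add: matrix_matrix_mult_def axis_def if_distrib[of "\<lambda>x. _ * x"]
          if_distrib[of "\<lambda>x. x $ _"] sum.delta cong: if_cong)
    then show ?thesis
      unfolding matrix_matrix_mult_def[of "B ** axis i (axis j u)"]
      by (simp add: if_distribR sum.delta if_distrib[of "\<lambda>x. x * _"] cong: if_cong)
  qed
  define a where "a i = (\<Sum>k\<in>UNIV. (norm (B $ k $ i))\<^sup>2)" for i
  define b where "b j = (\<Sum>k\<in>UNIV. (norm (T $ j $ k))\<^sup>2)" for j
  have "(norm (B ** axis i (axis j u) ** T))\<^sup>2 = a i * b j" if "u \<in> Basis" for i j u
    using that
    by (simp add: norm_matrix_eq_frobenius entry norm_mult power_mult_distrib sum_product a_def b_def)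
  then have "(\<Sum>b\<in>(Basis :: ('f^'p^'n) set). (norm (B ** b ** T))\<^sup>2) =
      (\<Sum>i\<in>UNIV. \<Sum>j\<in>UNIV. DIM('f) * (a i * b j))"
    by (simp add: sum_Basis_vec)
  also have "\<dots> = DIM('f) * (\<Sum>i\<in>UNIV. \<Sum>j\<in>UNIV. a i * b j)"
    by (simp only: sum_distrib_left)
  also have "(\<Sum>i\<in>UNIV. \<Sum>j\<in>UNIV. a i * b j) = sum a UNIV * sum b UNIV"
    by (rule sum_product[symmetric])
  also have "sum a UNIV = (norm B)\<^sup>2"
    unfolding a_def by (subst sum.swap) (simp add: norm_matrix_eq_frobenius)
  also have "sum b UNIV = (norm T)\<^sup>2"
    by (simp add: norm_matrix_eq_frobenius b_def)
  finally show ?thesis by (simp add: mult.assoc)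
qed

section \<open>Spans over the scalar field, distances and dual families\<close>

lemma matrix_vector_mult_sum_scale:
  "A *v (\<Sum>i\<in>I. c i *s x i) = (\<Sum>i\<in>I. c i *s (A *v (x i :: 'f::field^_)))"
  by (induction I rule: infinite_finite_induct)
     (auto simp: matrix_vector_right_distrib vector_scalar_commute)

text \<open>Coefficients range over \<open>'f\<close>, whereas \<open>span\<close> takes real ones.
  Indexing the family makes \<open>J - {j}\<close> drop one member even if vectors repeat, and keeps
  the coefficients independent of the vectors, which serves measurability later.\<close>

definition fspan :: "('j \<Rightarrow> 'f::rc_field^'n) \<Rightarrow> 'j set \<Rightarrow> ('f^'n) set" where
  "fspan g J = range (\<lambda>c. \<Sum>j\<in>J. c j *s g j)"

lemma scaleR_eq_scale: "r *\<^sub>R x = (r *\<^sub>R 1) *s (x :: 'f::rc_field^'n)"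
  by (simp add: vec_eq_iff)

lemma fspan_scale: "x \<in> fspan g J \<Longrightarrow> c *s x \<in> fspan g J"
  by (auto simp: fspan_def vec.scale_sum_right intro: image_eqI[where x="\<lambda>j. c * _ j"])

lemma subspace_fspan: "subspace (fspan g J)"
proof (intro subspaceI)
  show "0 \<in> fspan g J"
    unfolding fspan_def by (intro image_eqI[where x="\<lambda>_. 0"]) auto
  show "x + y \<in> fspan g J" if xy: "x \<in> fspan g J" "y \<in> fspan g J" for x y
  proof -
    obtain a b where "x = (\<Sum>j\<in>J. a j *s g j)" "y = (\<Sum>j\<in>J. b j *s g j)"
      using xy unfolding fspan_def by blast
    then show ?thesis
      unfolding fspan_def
      by (intro image_eqI[where x="\<lambda>j. a j + b j"]) (auto simp: vec.scale_left_distrib sum.distrib)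
  qed
  show "c *\<^sub>R x \<in> fspan g J" if "x \<in> fspan g J" for c x
    using fspan_scale[OF that] by (simp add: scaleR_eq_scale)
qed

text \<open>The dimension is the real one: each generator contributes its multiples by the
  \<open>DIM('f)\<close> real basis scalars.\<close>

lemma dim_fspan_le:
  fixes g :: "'j \<Rightarrow> 'f::rc_field^'n"
  assumes "finite J"
  shows "dim (fspan g J) \<le> DIM('f) * card J"
proof -
  let ?W = "\<Union>j\<in>J. (\<lambda>u. u *s g j) ` Basis"
  have "(\<Sum>j\<in>J. c j *s g j) \<in> span ?W" for c
  proof (intro span_sum)
    fix j assume j: "j \<in> J"
    have "c j *s g j = (\<Sum>u\<in>Basis. (c j \<bullet> u) *\<^sub>R (u *s g j))"
      by (subst euclidean_representation[of "c j", symmetric])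
         (simp add: vec_eq_iff sum_distrib_right sum_component)
    also have "\<dots> \<in> span ?W"
      using j by (intro span_sum span_scale span_base) auto
    finally show "c j *s g j \<in> span ?W" .
  qed
  then have "dim (fspan g J) \<le> card ?W"
    using assms by (intro dim_le_card) (auto simp: fspan_def)
  also have "\<dots> \<le> (\<Sum>j\<in>J. card ((\<lambda>u. u *s g j) ` (Basis :: 'f set)))"
    using assms by (rule card_UN_le)
  also have "\<dots> \<le> (\<Sum>j\<in>J. DIM('f))"
    by (intro sum_mono card_image_le) auto
  finally show ?thesis by (simp add: mult.commute)
qed

text \<open>The real orthogonal decomposition suffices: the span is closed under scalars of
  \<open>'f\<close>, so \<open>hdot_eq_0I\<close> upgrades the orthogonality of \<open>z\<close>.
  Pythagoras identifies its length with the distance.\<close>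

lemma fspan_residual:
  fixes x :: "'f::rc_field^'n"
  obtains y z where "y \<in> fspan g J" "x = y + z" "\<And>s. s \<in> fspan g J \<Longrightarrow> hdot z s = 0"
    "infdist x (fspan g J) = norm z"
proof -
  obtain y z where y: "y \<in> span (fspan g J)" and z: "\<And>w. w \<in> span (fspan g J) \<Longrightarrow> orthogonal z w"
    and x: "x = y + z"
    using orthogonal_subspace_decomp_exists[of "fspan g J" x] by metis
  have sp: "span (fspan g J) = fspan g J"
    by (simp add: subspace_fspan)
  have ne: "fspan g J \<noteq> {}" by (auto simp: fspan_def)
  have "norm z \<le> infdist x (fspan g J)"
    unfolding infdist_notempty[OF ne]
  proof (rule cINF_greatest[OF ne])
    fix s assume s: "s \<in> fspan g J"
    have "orthogonal z (y - s)"
      using s y by (intro z) (simp add: sp subspace_diff[OF subspace_fspan])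
    then have "(norm (z + (y - s)))\<^sup>2 = (norm z)\<^sup>2 + (norm (y - s))\<^sup>2"
      by (rule norm_add_Pythagorean)
    then have "(norm z)\<^sup>2 \<le> (dist x s)\<^sup>2"
      by (simp add: x dist_norm algebra_simps)
    then show "norm z \<le> dist x s"
      by (rule power2_le_imp_le) simp
  qed
  moreover have "infdist x (fspan g J) \<le> dist x y"
    using y by (intro infdist_le) (simp add: sp)
  ultimately have "infdist x (fspan g J) = norm z"
    by (simp add: x dist_norm)
  moreover have "hdot z s = 0" if "s \<in> fspan g J" for s
    using z fspan_scale[OF that] by (intro hdot_eq_0I) (simp add: sp orthogonal_def)
  ultimately show ?thesis
    using y x sp by (intro that) auto
qed

text \<open>The residual \<open>z\<close> of \<open>g j\<close> against the other members is
  orthogonal to all of them, and \<open>hdot z (g j)\<close> is its squared norm. Dividing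
  \<open>z\<close> by that square gives a dual vector of length one over the distance.\<close>

lemma dual_family_exists:
  fixes g :: "'j \<Rightarrow> 'f::rc_field^'n"
  assumes J: "finite J" and j: "j \<in> J" and pos: "infdist (g j) (fspan g (J - {j})) > 0"
  shows "\<exists>d. d \<in> fspan g J \<and> (norm d)\<^sup>2 = inverse ((infdist (g j) (fspan g (J - {j})))\<^sup>2) \<and>
     (\<forall>i\<in>J. hdot d (g i) = (if i = j then 1 else 0))"
proof -
  obtain y z where y: "y \<in> fspan g (J - {j})" and x: "g j = y + z"
    and z: "\<And>s. s \<in> fspan g (J - {j}) \<Longrightarrow> hdot z s = 0"
    and dist: "infdist (g j) (fspan g (J - {j})) = norm z"
    by (rule fspan_residual[where x="g j" and g=g and J="J - {j}"]) (rule that)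
  obtain c where c: "y = (\<Sum>i\<in>J - {j}. c i *s g i)" using y by (auto simp: fspan_def)
  have z0: "z \<noteq> 0" using pos by (auto simp: dist)
  have "z = g j - y" by (simp add: x)
  also have "\<dots> = (\<Sum>i\<in>J. (if i = j then 1 else - c i) *s g i)"
    using J j by (subst sum.remove[of J j]) (auto simp: c sum_negf intro!: sum.cong)
  finally have zJ: "z \<in> fspan g J"
    by (auto simp: fspan_def)
  have gi: "g i \<in> fspan g (J - {j})" if "i \<in> J" "i \<noteq> j" for i
  proof -
    have "g i = (\<Sum>k\<in>J - {j}. (if k = i then 1 else 0) *s g k)"
      using that J by (subst sum.remove[of "J - {j}" i]) auto
    then show ?thesis by (auto simp: fspan_def)
  qed
  have "hdot z (g j) = (norm z)\<^sup>2 *\<^sub>R 1"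
    by (simp add: x hdot_add_right z[OF y] hdot_self)
  then show ?thesis
    using z0 z gi
    by (intro exI[of _ "inverse ((norm z)\<^sup>2) *\<^sub>R z"])
       (auto simp: dist subspace_scale[OF subspace_fspan zJ] hdot_scaleR_left power_mult_distrib
          power2_eq_square field_simps)
qed

section \<open>Projections onto orthonormal families and right inverses of compressed
  matrices\<close>

definition fproj :: "('j \<Rightarrow> 'f::rc_field^'n) \<Rightarrow> 'j set \<Rightarrow> 'f^'n^'n" where
  "fproj v J = (\<Sum>j\<in>J. outer (v j) (v j))"

definition orthonormal_family :: "('j \<Rightarrow> 'f::rc_field^'n) \<Rightarrow> 'j set \<Rightarrow> bool" where
  "orthonormal_family v J \<longleftrightarrow> finite J \<and> (\<forall>i\<in>J. \<forall>j\<in>J. hdot (v i) (v j) = (if i = j then 1 else 0))"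

lemma orthonormal_family_subset: "orthonormal_family v J \<Longrightarrow> I \<subseteq> J \<Longrightarrow> orthonormal_family v I"
  unfolding orthonormal_family_def using finite_subset by blast

lemma fproj_mult_vector:
  assumes "orthonormal_family v J" "j \<in> J"
  shows "fproj v J *v v j = v j"
proof -
  have "fproj v J *v v j = (\<Sum>i\<in>J. hdot (v i) (v j) *s v i)"
    unfolding fproj_def
    by (simp add: outer_mult_vector[symmetric] vec_eq_iff matrix_vector_mult_def sum_component sum_distrib_right)
       (subst sum.swap, simp)
  also have "\<dots> = (\<Sum>i\<in>J. if i = j then v i else 0)"
    using assms by (intro sum.cong) (auto simp: orthonormal_family_def)
  finally show ?thesis
    using assms by (simp add: orthonormal_family_def)
qed

lemma conj_transpose_fproj [simp]: "conj_transpose (fproj v J) = fproj v J"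
  by (simp add: fproj_def conj_transpose_sum conj_transpose_outer)

lemma fproj_idem:
  assumes "orthonormal_family v J"
  shows "fproj v J ** fproj v J = fproj v J"
proof -
  have "fproj v J ** (\<Sum>j\<in>J. outer (v j) (v j)) = (\<Sum>j\<in>J. outer (fproj v J *v v j) (v j))"
    by (simp add: matrix_mult_sum_left matrix_mult_outer)
  then show ?thesis
    using assms by (simp add: fproj_mult_vector flip: fproj_def)
qed

text \<open>The witness is \<open>(P\<Omega>)\<^sup>\<dagger>\<close> written in terms of the dual basis of the family \<open>\<Omega>\<^sup>* v\<^sub>j\<close>;
  its Frobenius norm is read off the distances of each member to the span of the others.\<close>

lemma projected_right_inverse_exists:
  fixes \<Omega> :: "'f::rc_field^'q^'n"
  assumes v: "orthonormal_family v J"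
    and pos: "\<And>j. j \<in> J \<Longrightarrow>
      infdist (conj_transpose \<Omega> *v v j) (fspan (\<lambda>i. conj_transpose \<Omega> *v v i) (J - {j})) > 0"
  obtains T C where "T ** fproj v J = T" "fproj v J ** \<Omega> ** T = fproj v J"
    "T = conj_transpose \<Omega> ** fproj v J ** C"
    "(norm T)\<^sup>2 = (\<Sum>j\<in>J. inverse ((infdist (conj_transpose \<Omega> *v v j)
        (fspan (\<lambda>i. conj_transpose \<Omega> *v v i) (J - {j})))\<^sup>2))"
proof -
  let ?P = "fproj v J"
  define g where "g = (\<lambda>i. conj_transpose \<Omega> *v v i)"
  have J: "finite J" and on: "\<And>i j. i \<in> J \<Longrightarrow> j \<in> J \<Longrightarrow> hdot (v i) (v j) = (if i = j then 1 else 0)"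
    using v by (auto simp: orthonormal_family_def)
  have "\<forall>j\<in>J. \<exists>d. d \<in> fspan g J \<and> (norm d)\<^sup>2 = inverse ((infdist (g j) (fspan g (J - {j})))\<^sup>2) \<and>
     (\<forall>i\<in>J. hdot d (g i) = (if i = j then 1 else 0))"
    using pos J by (intro ballI dual_family_exists) (auto simp: g_def)
  then obtain d where d: "\<And>j. j \<in> J \<Longrightarrow> d j \<in> fspan g J"
      "\<And>j. j \<in> J \<Longrightarrow> (norm (d j))\<^sup>2 = inverse ((infdist (g j) (fspan g (J - {j})))\<^sup>2)"
      "\<And>i j. i \<in> J \<Longrightarrow> j \<in> J \<Longrightarrow> hdot (d j) (g i) = (if i = j then 1 else 0)"
    by metis
  define T where "T = (\<Sum>j\<in>J. outer (d j) (v j))"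
  have "T ** ?P = (\<Sum>j\<in>J. outer (d j) (?P *v v j))"
    by (simp add: T_def matrix_mult_sum_right outer_matrix_mult)
  then have 1: "T ** ?P = T"
    using v by (simp add: fproj_mult_vector T_def)
  have "?P ** \<Omega> = (\<Sum>i\<in>J. outer (v i) (g i))"
    by (simp add: fproj_def matrix_mult_sum_right outer_matrix_mult g_def)
  then have "?P ** \<Omega> ** outer x y = (\<Sum>i\<in>J. outer (v i) (g i) ** outer x y)" for x and y :: "'f^'n"
    by (simp only: matrix_mult_sum_right)
  then have "?P ** \<Omega> ** T = (\<Sum>j\<in>J. \<Sum>i\<in>J. outer (hdot (g i) (d j) *s v i) (v j))"
    by (simp add: T_def matrix_mult_sum_left) (simp add: matrix_mult_outer outer_mult_vector)
  also have "\<dots> = (\<Sum>j\<in>J. \<Sum>i\<in>J. if i = j then outer (v j) (v j) else 0)"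
    by (intro sum.cong refl) (subst hdot_commute, auto simp: d(3))
  finally have 2: "?P ** \<Omega> ** T = ?P"
    using J by (simp add: fproj_def)
  obtain c where c: "\<And>j. j \<in> J \<Longrightarrow> d j = (\<Sum>i\<in>J. c j i *s g i)"
    using d(1) unfolding fspan_def image_iff by metis
  \<comment> \<open>Each \<open>d j\<close> is a combination of the vectors \<open>g i\<close>; the
    same coefficients on the \<open>v i\<close> form \<open>C\<close>. The resulting factorization
    confines the range of \<open>T\<close>, which later identifies \<open>T\<close> in the
    least-squares step.\<close>
  define C where "C = (\<Sum>j\<in>J. outer (\<Sum>i\<in>J. c j i *s v i) (v j))"
  have dj: "(conj_transpose \<Omega> ** ?P) *v (\<Sum>i\<in>J. c j i *s v i) = d j" if "j \<in> J" for j
    using v by (simp add: c[OF that] g_def matrix_vector_mul_assoc[symmetric]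
        matrix_vector_mult_sum_scale fproj_mult_vector)
  have 3: "T = conj_transpose \<Omega> ** ?P ** C"
    by (simp add: C_def T_def matrix_mult_sum_left matrix_mult_outer dj)
  have "(norm T)\<^sup>2 = (\<Sum>j\<in>J. (norm (outer (d j) (v j)))\<^sup>2)"
    unfolding T_def using J
    by (intro norm_sum_Pythagorean) (auto simp: pairwise_def on intro!: orthogonal_outer)
  also have "\<dots> = (\<Sum>j\<in>J. (norm (d j))\<^sup>2)"
  proof (intro sum.cong refl)
    fix j assume "j \<in> J"
    then have "(norm (v j))\<^sup>2 *\<^sub>R (1::'f) = 1 *\<^sub>R 1"
      using on[of j j] by (simp add: hdot_self)
    then have "(norm (v j))\<^sup>2 = 1" by (simp only: scaleR_cancel_right) simp
    then show "(norm (outer (d j) (v j)))\<^sup>2 = (norm (d j))\<^sup>2"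
      by (simp add: norm_outer power_mult_distrib)
  qed
  also have "\<dots> = (\<Sum>j\<in>J. inverse ((infdist (g j) (fspan g (J - {j})))\<^sup>2))"
    by (simp add: d(2))
  finally have 4: "(norm T)\<^sup>2 = \<dots>" .
  show ?thesis
    using that[OF 1 2 3] 4 by (simp add: g_def)
qed

section \<open>Gaussian compressions\<close>

text \<open>For fixed coefficients \<open>c\<close> the distance to that combination is continuous
  in \<open>x\<close>. A strict sublevel set of the infimum is the union over \<open>c\<close> of
  open sets, hence open.\<close>

lemma borel_measurable_infdist_fspan:
  fixes u :: "'a::euclidean_space \<Rightarrow> 'f::rc_field^'n" and g :: "'j \<Rightarrow> 'a \<Rightarrow> 'f^'n"
  assumes u: "linear u" and g: "\<And>j. linear (g j)"
  shows "(\<lambda>x. infdist (u x) (fspan (\<lambda>j. g j x) J)) \<in> borel_measurable borel"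
proof (subst borel_measurable_iff_less, intro allI)
  fix t :: real
  have ne: "fspan (\<lambda>j. g j x) J \<noteq> {}" for x by (auto simp: fspan_def)
  have "{x. infdist (u x) (fspan (\<lambda>j. g j x) J) < t} =
      (\<Union>c. {x. norm (u x - (\<Sum>j\<in>J. c j *s g j x)) < t})"
    unfolding infdist_notempty[OF ne]
    by (subst cINF_less_iff[OF ne]) (auto simp: fspan_def dist_norm intro!: bdd_belowI[of _ 0])
  moreover have "open {x. norm (u x - (\<Sum>j\<in>J. c j *s g j x)) < t}" for c
  proof -
    have "linear (\<lambda>x. c j *s g j x)" for j
      using g[of j] by (intro linearI) (simp_all add: linear_add linear_scale vec_eq_iff algebra_simps)
    then have "linear (\<lambda>x. u x - (\<Sum>j\<in>J. c j *s g j x))"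
      by (intro linear_compose_sub u linear_compose_sum) auto
    then have "continuous_on UNIV (\<lambda>x. u x - (\<Sum>j\<in>J. c j *s g j x))"
      by (simp add: linear_continuous_on linear_conv_bounded_linear)
    then show ?thesis
      by (intro open_Collect_less continuous_on_norm continuous_on_const)
  qed
  ultimately show "{x \<in> space borel. infdist (u x) (fspan (\<lambda>j. g j x) J) < t} \<in> sets borel"
    by (simp add: open_UN borel_open)
qed

definition gdist :: "('j \<Rightarrow> 'f::rc_field^'n) \<Rightarrow> 'j set \<Rightarrow> 'f^'q^'n \<Rightarrow> 'j \<Rightarrow> real" where
  "gdist v J \<Omega> j =
     infdist (conj_transpose \<Omega> *v v j) (fspan (\<lambda>i. conj_transpose \<Omega> *v v i) (J - {j}))"

lemma linear_conj_transpose_vector: "linear (\<lambda>\<Omega>. conj_transpose \<Omega> *v (w :: 'f::rc_field^_))"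
  by (intro linearI)
     (simp_all add: conj_transpose_add conj_transpose_scaleR vec_eq_iff matrix_vector_mult_def
        algebra_simps sum.distrib scaleR_sum_right)

lemma borel_measurable_gdist [measurable]: "(\<lambda>\<Omega>. gdist v J \<Omega> j) \<in> borel_measurable borel"
  unfolding gdist_def by (intro borel_measurable_infdist_fspan linear_conj_transpose_vector)

lemma linear_matrix_mult_left: "linear (\<lambda>X. A ** (X :: 'f::rc_field^_^_))"
  and linear_matrix_mult_right: "linear (\<lambda>X. X ** (B :: 'f::rc_field^_^_))"
  by (intro linearI; simp add: matrix_mult_add_left matrix_mult_add_right
      matrix_mult_scaleR_left matrix_mult_scaleR_right)+

lemma inner_conj_transpose_vector:
  "inner (conj_transpose Y *v v) y = inner Y (outer v (y :: 'f::rc_field^_))"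
proof -
  have *: "inner (conjugate a * b) c = inner a (b * conjugate c)" for a b c :: 'f
  proof -
    have "inner (conjugate a * b) c = inner 1 (conjugate (conjugate a * b) * c)"
      by (rule inner_eq_inner_one)
    also have "\<dots> = inner (conjugate 1) (conjugate (conjugate (conjugate a * b) * c))"
      by (rule rc_inner_conjugate[symmetric])
    also have "\<dots> = inner 1 (conjugate a * (b * conjugate c))"
      by (simp add: conjugate_dist_mul mult_ac)
    also have "\<dots> = inner a (b * conjugate c)"
      by (rule inner_eq_inner_one[symmetric])
    finally show ?thesis .
  qed
  show ?thesis
    unfolding inner_vec_def[of Y] inner_vec_def[of "Y $ _"]
    by (subst sum.swap) (simp add: inner_vec_def matrix_vector_mult_def inner_sum_left outer_def *)
qed

text \<open>The map is real-linear with adjoint \<open>outer v\<close>, which is a right inverse of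
  it because \<open>v\<close> has unit length.\<close>

lemma distr_gauss_conj_transpose_vector:
  fixes v :: "'f::rc_field^'n"
  assumes "hdot v v = 1"
  shows "distr gauss borel (\<lambda>Y :: 'f^'q^'n. conj_transpose Y *v v) = gauss"
proof (rule distr_gauss_coisometry[OF linear_conj_transpose_vector _ inner_conj_transpose_vector])
  show "linear (outer v :: 'f^'q \<Rightarrow> _)"
    by (intro linearI) (simp_all add: vec_eq_iff outer_def conjugate_dist_add rc_conjugate_scaleR algebra_simps)
  show "conj_transpose (outer v y) *v v = y" for y
    using assms by (simp add: conj_transpose_outer outer_mult_vector)
qed

lemma distr_gauss_conj_transpose:
  "distr (gauss :: ('f::rc_field^'n^'m) measure) borel conj_transpose = gauss"
  by (rule distr_gauss_coisometry[OF linear_conj_transpose linear_conj_transpose inner_conj_transpose]) simp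

text \<open>Splitting \<Omega> along \<open>v j\<close> makes
  \<open>conj_transpose \<Omega> *v v j\<close> independent of the other vectors. With those fixed,
  it is a Gaussian vector whose distance is taken from a fixed subspace, so the inverse chi-square
  bound applies.\<close>

lemma nn_integral_inverse_gdist:
  fixes v :: "'j \<Rightarrow> 'f::rc_field^'n"
  assumes v: "orthonormal_family v J" and j: "j \<in> J"
    and card: "2 + DIM('f) * card J < DIM('f) * (CARD('q::finite) + 1)"
  shows "(\<integral>\<^sup>+\<Omega>. inverse (ennreal ((gdist v J (\<Omega> :: 'f^'q^'n) j)\<^sup>2)) \<partial>gauss)
    \<le> ennreal (1 / (real DIM('f) * (real CARD('q) + 1 - real (card J)) - 2))"
proof -
  let ?b = "DIM('f)"
  have J: "finite J" and on: "\<And>i k. i \<in> J \<Longrightarrow> k \<in> J \<Longrightarrow> hdot (v i) (v k) = (if i = k then 1 else 0)"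
    using v by (auto simp: orthonormal_family_def)
  have vj: "hdot (v j) (v j) = 1" using on j by simp
  define Q where "Q = fproj v {j}"
  have Q: "conj_transpose Q = Q" "Q ** Q = Q"
    using orthonormal_family_subset[OF v, of "{j}"] j by (auto simp: Q_def fproj_idem)
  have Qv: "Q *v v i = (if i = j then v j else 0)" if "i \<in> J" for i
    using that j on by (simp add: Q_def fproj_def outer_mult_vector)
  \<comment> \<open>\<open>Y\<close> supplies the component along \<open>v j\<close> and
    \<open>X\<close> the rest. The last summand is \<open>Q ** Y\<close>, written to match
    \<open>nn_integral_gauss_split\<close> for the projection sending \<open>X\<close> to
    \<open>X - Q ** X\<close>.\<close>
  define \<Omega> where "\<Omega> X Y = X - Q ** X + (Y - (Y - Q ** Y))" for X Y :: "'f^'q^'n"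
  have \<Omega>v: "conj_transpose (\<Omega> X Y) *v v i = conj_transpose (if i = j then Y else X) *v v i"
    if "i \<in> J" for X Y i
    using that
    by (simp add: \<Omega>_def conj_transpose_add conj_transpose_diff conj_transpose_mult Q(1)
        matrix_vector_mult_add_rdistrib matrix_vector_mult_diff_rdistrib matrix_vector_mul_assoc[symmetric] Qv)
  have gd: "gdist v J (\<Omega> X Y) j = infdist (conj_transpose Y *v v j) (fspan (\<lambda>i. conj_transpose X *v v i) (J - {j}))"
    for X Y
    unfolding gdist_def fspan_def using j
    by (intro arg_cong2[where f=infdist] arg_cong[where f=range] ext sum.cong) (auto simp: \<Omega>v)
  have "(\<integral>\<^sup>+\<Omega>. inverse (ennreal ((gdist v J (\<Omega> :: 'f^'q^'n) j)\<^sup>2)) \<partial>gauss)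
    \<le> (\<integral>\<^sup>+X. \<integral>\<^sup>+Y. inverse (ennreal ((gdist v J (\<Omega> X Y) j)\<^sup>2)) \<partial>gauss \<partial>gauss)"
    unfolding \<Omega>_def
  proof (rule nn_integral_gauss_split[where P="\<lambda>X. X - Q ** X"])
    show "linear (\<lambda>X. X - Q ** X)"
      by (intro linear_compose_sub linear_id[unfolded id_def] linear_matrix_mult_left)
    show "inner (X - Q ** X) Y = inner X (Y - Q ** Y)" for X Y
      by (simp add: inner_diff_left inner_diff_right inner_matrix_mult_left Q)
    show "X - Q ** X - Q ** (X - Q ** X) = X - Q ** X" for X
      by (simp add: matrix_mult_diff_left matrix_mul_assoc Q)
  qed
  also have "\<dots> \<le> (\<integral>\<^sup>+X. ennreal (1 / (real ?b * (real CARD('q) + 1 - real (card J)) - 2)) \<partial>(gauss :: ('f^'q^'n) measure))"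
  proof (intro nn_integral_mono)
    fix X :: "'f^'q^'n"
    let ?V = "fspan (\<lambda>i. conj_transpose X *v v i) (J - {j})"
    \<comment> \<open>A lower bound for the real codimension of \<open>?V\<close>. Only
      \<open>card J - 1\<close> vectors generate \<open>?V\<close>, hence the
      \<open>+ 1\<close>.\<close>
    let ?d = "?b * (CARD('q) + 1) - ?b * card J"
    have "dim ?V \<le> ?b * card (J - {j})"
      using J by (intro dim_fspan_le) auto
    also have "card (J - {j}) = card J - 1"
      using J j by simp
    finally have "dim ?V \<le> ?b * card J - ?b"
      by (simp add: diff_mult_distrib2)
    moreover have "card J \<ge> 1" using J j by (metis One_nat_def Suc_leI card_gt_0_iff empty_iff)
    then have "?b \<le> ?b * card J" by simp
    moreover have "DIM('f^'q) = ?b * CARD('q)" "?b * (CARD('q) + 1) = ?b * CARD('q) + ?b"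
      by simp_all
    ultimately have d: "?d + dim ?V \<le> DIM('f^'q)" "?d > 2"
      using card by linarith+
    have "(\<integral>\<^sup>+Y. inverse (ennreal ((infdist (conj_transpose (Y :: 'f^'q^'n) *v v j) ?V)\<^sup>2)) \<partial>gauss) =
        (\<integral>\<^sup>+y. inverse (ennreal ((infdist y ?V)\<^sup>2)) \<partial>distr gauss borel (\<lambda>Y :: 'f^'q^'n. conj_transpose Y *v v j))"
    proof -
      have 1: "(\<lambda>Y :: 'f^'q^'n. conj_transpose Y *v v j) \<in> gauss \<rightarrow>\<^sub>M borel"
        by (subst measurable_cong_sets[OF sets_gauss refl])
          (rule linear_borel_measurable[OF linear_conj_transpose_vector])
      have [measurable]: "(\<lambda>y. infdist y ?V) \<in> borel_measurable borel"
        by (intro borel_measurable_continuous_onI continuous_on_infdist continuous_on_id)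
      have 2: "(\<lambda>y. inverse (ennreal ((infdist y ?V)\<^sup>2))) \<in> borel_measurable borel"
        by measurable
      show ?thesis
        by (rule nn_integral_distr[symmetric, OF 1]) (use 2 in simp)
    qed
    also have "\<dots> \<le> ennreal (1 / (real ?d - 2))"
      unfolding distr_gauss_conj_transpose_vector[OF vj]
      by (rule nn_integral_gauss_inverse_infdist[OF subspace_fspan d])
    also have "real ?d - 2 = real ?b * (real CARD('q) + 1 - real (card J)) - 2"
      using card by (simp add: of_nat_diff algebra_simps)
    finally show "(\<integral>\<^sup>+Y. inverse (ennreal ((gdist v J (\<Omega> X Y) j)\<^sup>2)) \<partial>gauss)
        \<le> ennreal (1 / (real ?b * (real CARD('q) + 1 - real (card J)) - 2))"
      unfolding gd .
  qed
  also have "\<dots> = ennreal (1 / (real ?b * (real CARD('q) + 1 - real (card J)) - 2))"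
    using gauss.emeasure_space_1[where 'a="'f^'q^'n"] by simp
  finally show ?thesis .
qed

text \<open>Since \<open>A - A ** P\<close> annihilates \<open>P\<close>, the product
  \<open>A ** \<Omega> ** T\<close> equals \<open>A ** P\<close> plus a term that sees only
  \<open>Y\<close>. That term is unchanged by \<open>P\<close> on the right, so it is orthogonal to
  \<open>A - A ** P\<close>.\<close>

lemma norm_sq_compression:
  fixes A :: "'f::rc_field^'n^'p"
  assumes P: "conj_transpose P = P" "P ** P = P" and T: "T ** P = T" "P ** \<Omega> ** T = P"
    and \<Omega>: "\<Omega> = P ** X + (Y - P ** Y)"
  shows "(norm (A - A ** \<Omega> ** T))\<^sup>2 = (norm (A - A ** P))\<^sup>2 + (norm ((A - A ** P) ** Y ** T))\<^sup>2"
proof -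
  let ?B = "A - A ** P"
  have BP: "?B ** P = 0"
    by (simp add: matrix_mult_diff_right matrix_mul_assoc[symmetric] P)
  have "A ** \<Omega> ** T = A ** (P ** \<Omega> ** T) + ?B ** \<Omega> ** T"
    by (simp add: matrix_mult_diff_right matrix_mul_assoc)
  also have "?B ** \<Omega> = ?B ** Y"
    by (simp add: \<Omega> matrix_mult_add_left matrix_mult_diff_left matrix_mul_assoc BP)
  finally have "A - A ** \<Omega> ** T = ?B + - (?B ** Y ** T)"
    by (simp add: T)
  moreover have "inner ?B (?B ** Y ** T) = 0"
  proof -
    have "inner ?B (?B ** Y ** T) = inner ?B (?B ** Y ** T ** P)"
      by (simp add: T matrix_mul_assoc[symmetric])
    also have "\<dots> = inner (?B ** P) (?B ** Y ** T)"
      by (simp add: inner_matrix_mult_right P)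
    finally show ?thesis by (simp only: BP inner_zero_left)
  qed
  then have "orthogonal ?B (- (?B ** Y ** T))"
    by (simp add: orthogonal_def)
  ultimately show ?thesis
    by (simp only: norm_add_Pythagorean) (simp add: norm_minus_cancel)
qed

text \<open>\<open>\<Phi>\<close> stands for any error dominated by the compression error for every
  admissible \<open>T\<close>, so that both halves of the bound can be instances. In the constant,
  \<open>DIM('f)\<close> comes from averaging over \<open>Y\<close> and the remaining fraction from
  the mean of the squared norm of \<open>T\<close>.\<close>

lemma nn_integral_compression_le:
  fixes A :: "'f::rc_field^'n^'p" and v :: "'j \<Rightarrow> 'f^'n" and J :: "'j set" and \<Phi> :: "'f^'q^'n \<Rightarrow> ennreal"
  defines "P \<equiv> fproj v J"
  assumes v: "orthonormal_family v J"
    and card: "2 + DIM('f) * card J < DIM('f) * (CARD('q) + 1)"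
    and \<Phi>: "\<And>\<Omega> T C. T ** P = T \<Longrightarrow> P ** \<Omega> ** T = P \<Longrightarrow> T = conj_transpose \<Omega> ** P ** C \<Longrightarrow>
       \<Phi> \<Omega> \<le> ennreal ((norm (A - A ** \<Omega> ** T))\<^sup>2)"
  shows "(\<integral>\<^sup>+\<Omega>. \<Phi> \<Omega> \<partial>gauss) \<le>
    ennreal ((1 + DIM('f) * card J / (real DIM('f) * (real CARD('q) + 1 - real (card J)) - 2)) * (norm (A - A ** P))\<^sup>2)"
proof -
  have P: "conj_transpose P = P" "P ** P = P"
    using v by (auto simp: P_def fproj_idem)
  let ?B = "A - A ** P" and ?b = "DIM('f)"
  let ?e = "1 / (real ?b * (real CARD('q) + 1 - real (card J)) - 2)"
  define S where "S X = (\<Sum>j\<in>J. inverse (ennreal ((gdist v J X j)\<^sup>2)))" for X :: "'f^'q^'n"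
  have e0: "?e \<ge> 0"
  proof -
    have "real (2 + ?b * card J) < real (?b * (CARD('q) + 1))"
      using card by (simp only: of_nat_less_iff)
    then have "real ?b * (real CARD('q) + 1 - real (card J)) - 2 > 0" by (simp add: algebra_simps)
    then show ?thesis by simp
  qed
  have S: "(\<integral>\<^sup>+X. S X \<partial>gauss) \<le> ennreal (card J * ?e)"
  proof -
    have "(\<integral>\<^sup>+X. S X \<partial>gauss) = (\<Sum>j\<in>J. \<integral>\<^sup>+X. inverse (ennreal ((gdist v J X j)\<^sup>2)) \<partial>(gauss :: ('f^'q^'n) measure))"
      unfolding S_def by (subst nn_integral_sum) auto
    also have "\<dots> \<le> (\<Sum>j\<in>J. ennreal ?e)"
      by (intro sum_mono nn_integral_inverse_gdist v card)
    also have "\<dots> = ennreal (card J * ?e)"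
      by (simp only: sum_constant ennreal_of_nat_eq_real_of_nat ennreal_mult[OF of_nat_0_le_iff e0])
    finally show ?thesis .
  qed
  have [measurable]: "S \<in> borel_measurable borel" unfolding S_def by measurable
  \<comment> \<open>A vanishing distance would make \<open>S X\<close> infinite, so the finite mean
    gives a right inverse for almost every \<open>X\<close>.\<close>
  have "AE X in gauss. S X \<noteq> \<infinity>"
    using S by (intro nn_integral_PInf_AE) (auto simp: top_unique)
  then have pos: "AE X in (gauss :: ('f^'q^'n) measure). \<forall>j\<in>J. gdist v J X j > 0"
  proof (rule AE_mp, intro AE_I2 impI ballI)
    fix X j assume "S X \<noteq> \<infinity>" and j: "j \<in> J"
    then have "gdist v J X j \<noteq> 0"
      using v by (auto simp: S_def orthonormal_family_def)
    then show "gdist v J X j > 0"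
      using infdist_nonneg by (metis gdist_def less_eq_real_def)
  qed
  have "(\<integral>\<^sup>+\<Omega>. \<Phi> \<Omega> \<partial>gauss) \<le> (\<integral>\<^sup>+X. \<integral>\<^sup>+Y. \<Phi> (P ** X + (Y - P ** Y)) \<partial>gauss \<partial>gauss)"
  proof (rule nn_integral_gauss_split)
    show "linear (\<lambda>X. P ** X)" by (rule linear_matrix_mult_left)
  qed (simp_all add: inner_matrix_mult_left P matrix_mul_assoc)
  also have "\<dots> \<le> (\<integral>\<^sup>+X. ennreal ((norm ?B)\<^sup>2) * (1 + ennreal ?b * S X) \<partial>gauss)"
  proof (rule nn_integral_mono_AE, rule AE_mp[OF pos], intro AE_I2 impI)
    fix X :: "'f^'q^'n" assume gd: "\<forall>j\<in>J. gdist v J X j > 0"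
    then have "\<And>j. j \<in> J \<Longrightarrow> infdist (conj_transpose X *v v j)
        (fspan (\<lambda>i. conj_transpose X *v v i) (J - {j})) > 0"
      by (simp add: gdist_def)
    note ex = projected_right_inverse_exists[OF v this, folded gdist_def P_def]
    obtain T C where T: "T ** P = T" "P ** X ** T = P" "T = conj_transpose X ** P ** C"
      and nT: "(norm T)\<^sup>2 = (\<Sum>j\<in>J. inverse ((gdist v J X j)\<^sup>2))"
      by (rule ex) (assumption, rule that)
    have "(\<integral>\<^sup>+Y. \<Phi> (P ** X + (Y - P ** Y)) \<partial>gauss)
      \<le> (\<integral>\<^sup>+Y. ennreal ((norm ?B)\<^sup>2) + ennreal ((norm (?B ** Y ** T))\<^sup>2) \<partial>(gauss :: ('f^'q^'n) measure))"
    proof (rule nn_integral_mono)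
      fix Y :: "'f^'q^'n"
      let ?\<Omega> = "P ** X + (Y - P ** Y)"
      \<comment> \<open>\<open>T\<close> is built from \<open>X\<close> alone. Replacing the part of
        \<open>X\<close> outside the range of \<open>P\<close> by that of \<open>Y\<close> leaves
        \<open>P ** X\<close> unchanged, so the same \<open>T\<close> is admissible for every
        \<open>Y\<close>.\<close>
      have P\<Omega>: "P ** ?\<Omega> = P ** X"
        by (simp add: matrix_mult_add_left matrix_mult_diff_left matrix_mul_assoc P)
      have \<Omega>P: "conj_transpose ?\<Omega> ** P = conj_transpose X ** P"
        by (metis P\<Omega> P(1) conj_transpose_mult)
      have "\<Phi> ?\<Omega> \<le> ennreal ((norm (A - A ** ?\<Omega> ** T))\<^sup>2)"
        by (rule \<Phi>[where T=T and C=C]) (simp_all only: T(1,2) P\<Omega> \<Omega>P T(3)[symmetric])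
      also have "\<dots> = ennreal ((norm ?B)\<^sup>2 + (norm (?B ** Y ** T))\<^sup>2)"
        by (subst norm_sq_compression[OF P T(1) _ refl]) (simp_all only: P\<Omega> T(2))
      finally show "\<Phi> ?\<Omega> \<le> ennreal ((norm ?B)\<^sup>2) + ennreal ((norm (?B ** Y ** T))\<^sup>2)"
        by simp
    qed
    also have "\<dots> = ennreal ((norm ?B)\<^sup>2) + (\<integral>\<^sup>+Y. ennreal ((norm (?B ** Y ** T))\<^sup>2) \<partial>(gauss :: ('f^'q^'n) measure))"
    proof -
      have [measurable]: "(\<lambda>Y :: 'f^'q^'n. ?B ** Y ** T) \<in> borel_measurable borel"
        by (intro linear_borel_measurable linear_compose[OF linear_matrix_mult_left linear_matrix_mult_right, unfolded comp_def])
      show ?thesis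
        using gauss.emeasure_space_1[where 'a="'f^'q^'n"] by (subst nn_integral_add) auto
    qed
    also have "(\<integral>\<^sup>+Y. ennreal ((norm (?B ** Y ** T))\<^sup>2) \<partial>(gauss :: ('f^'q^'n) measure)) =
        ennreal (?b * (norm ?B)\<^sup>2 * (norm T)\<^sup>2)"
      by (subst nn_integral_gauss_linear_sq)
         (auto simp only: sum_Basis_norm_sq intro!: linear_compose[OF linear_matrix_mult_left linear_matrix_mult_right, unfolded comp_def])
    also have "ennreal (?b * (norm ?B)\<^sup>2 * (norm T)\<^sup>2) = ennreal ((norm ?B)\<^sup>2) * (ennreal ?b * ennreal ((norm T)\<^sup>2))"
      by (simp add: ennreal_mult mult_ac)
    also have "ennreal ((norm T)\<^sup>2) = S X"
    proof -
      have "S X = (\<Sum>j\<in>J. ennreal (inverse ((gdist v J X j)\<^sup>2)))"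
        unfolding S_def using gd by (intro sum.cong) (auto simp: inverse_ennreal)
      then show ?thesis by (simp add: nT)
    qed
    finally show "(\<integral>\<^sup>+Y. \<Phi> (P ** X + (Y - P ** Y)) \<partial>gauss) \<le> ennreal ((norm ?B)\<^sup>2) * (1 + ennreal ?b * S X)"
      by (simp add: distrib_left)
  qed
  also have "\<dots> = ennreal ((norm ?B)\<^sup>2) * (1 + ennreal ?b * (\<integral>\<^sup>+X. S X \<partial>gauss))"
    using gauss.emeasure_space_1[where 'a="'f^'q^'n"]
    by (simp add: nn_integral_cmult nn_integral_add)
  also have "\<dots> \<le> ennreal ((norm ?B)\<^sup>2) * (1 + ennreal ?b * ennreal (card J * ?e))"
    by (intro mult_left_mono add_left_mono S) auto
  also have "\<dots> = ennreal ((norm ?B)\<^sup>2 * (1 + ?b * (card J * ?e)))"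
    using e0 by (simp add: ennreal_mult[symmetric] ennreal_plus[symmetric] ennreal_1[symmetric] del: ennreal_plus ennreal_1)
  finally show ?thesis by (simp add: mult.commute)
qed

section \<open>Laws of random matrices and the pseudoinverse\<close>

lemma distr_eq_gaussI:
  fixes X :: "'w \<Rightarrow> 'a::euclidean_space"
  assumes [measurable]: "X \<in> borel_measurable M"
    and X: "distr M (\<Pi>\<^sub>M b\<in>Basis. borel) (\<lambda>\<omega>. \<lambda>b\<in>Basis. X \<omega> \<bullet> b) = (\<Pi>\<^sub>M b\<in>Basis. gauss)"
  shows "distr M borel X = gauss"
proof -
  have "gauss = distr (distr M (\<Pi>\<^sub>M b\<in>(Basis :: 'a set). borel) (\<lambda>\<omega>. \<lambda>b\<in>Basis. X \<omega> \<bullet> b)) borel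
      (\<lambda>f. \<Sum>b\<in>Basis. f b *\<^sub>R b)"
    by (subst gauss_eq_distr_PiM) (simp add: X)
  also have "\<dots> = distr M borel (\<lambda>\<omega>. \<Sum>b\<in>Basis. (\<lambda>b\<in>Basis. X \<omega> \<bullet> b) b *\<^sub>R b)"
    by (subst distr_distr) (auto simp: comp_def)
  also have "\<dots> = distr M borel X"
    by (simp add: euclidean_representation)
  finally show ?thesis ..
qed

lemma real_std_normal_matrix_distr:
  fixes G :: "'w \<Rightarrow> real^'c^'r"
  assumes M: "prob_space M" and G: "real_std_normal_matrix M G"
  shows "G \<in> borel_measurable M" "distr M borel G = gauss"
proof -
  interpret prob_space M by fact
  have D: "distributed M lborel (\<lambda>\<omega>. G \<omega> $ i $ j) std_normal_density" for i j
    using G by (simp add: real_std_normal_matrix_def)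
  have [measurable]: "(\<lambda>\<omega>. G \<omega> $ i $ j) \<in> borel_measurable M" for i j
    using distributed_measurable[OF D[of i j]] by simp
  have entry: "distr M borel (\<lambda>\<omega>. G \<omega> $ i $ j) = gauss" for i j
  proof -
    have "distr M borel (\<lambda>\<omega>. G \<omega> $ i $ j) = distr M lborel (\<lambda>\<omega>. G \<omega> $ i $ j)"
      by (rule distr_cong) auto
    then show ?thesis
      using distributed_distr_eq_density[OF D[of i j]] by (simp add: gauss_real)
  qed
  \<comment> \<open>Index pairs correspond to the canonical basis matrices. Along this bijection the
    joint law of the entries, a product over pairs, becomes a product over
    \<open>Basis\<close>.\<close>
  define h where "h = (\<lambda>(i, j). axis i (axis j 1) :: real^'c^'r)"
  have inj: "inj h"
    by (auto simp: h_def inj_def axis_eq_axis)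
  have range: "range h = Basis"
    by (auto simp: h_def Basis_vec_def image_iff)
  have bij: "bij_betw (inv h) Basis UNIV"
    using bij_betw_inv_into[of h UNIV Basis] inj range unfolding bij_betw_def by blast
  have G_entry: "G \<omega> \<bullet> b = (case inv h b of (i, j) \<Rightarrow> G \<omega> $ i $ j)" if "b \<in> Basis" for \<omega> b
  proof -
    have "b \<in> range h" unfolding range by (rule that)
    then obtain p where "b = h p" by (rule rangeE)
    then have b: "b = h (fst p, snd p)" by simp
    then show ?thesis
      using inv_f_f[OF inj, of "(fst p, snd p)"] by (simp add: h_def inner_axis case_prod_beta)
  qed
  show meas [measurable]: "G \<in> borel_measurable M"
    by (subst borel_measurable_euclidean_space) (auto simp: G_entry split: prod.split)
  have "indep_vars (\<lambda>_. borel) (\<lambda>(i, j) \<omega>. G \<omega> $ i $ j) UNIV"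
    using G by (simp add: real_std_normal_matrix_def)
  then have "distr M (\<Pi>\<^sub>M p\<in>UNIV. borel) (\<lambda>\<omega>. \<lambda>p\<in>UNIV. case p of (i, j) \<Rightarrow> G \<omega> $ i $ j) =
      (\<Pi>\<^sub>M p\<in>UNIV. distr M borel (\<lambda>\<omega>. case p of (i, j) \<Rightarrow> G \<omega> $ i $ j))"
    by (subst (asm) indep_vars_iff_distr_eq_PiM) (auto simp: case_prod_beta)
  also have "\<dots> = (\<Pi>\<^sub>M p\<in>(UNIV :: ('r \<times> 'c) set). gauss)"
    by (simp add: case_prod_beta entry)
  finally have law: "distr M (\<Pi>\<^sub>M p\<in>UNIV. borel) (\<lambda>\<omega> p. case p of (i, j) \<Rightarrow> G \<omega> $ i $ j) =
      (\<Pi>\<^sub>M p\<in>(UNIV :: ('r \<times> 'c) set). (gauss :: real measure))"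
    by (simp add: restrict_def)
  have ms [measurable]: "(\<lambda>\<omega> p. case p of (i, j) \<Rightarrow> G \<omega> $ i $ j) \<in> M \<rightarrow>\<^sub>M (\<Pi>\<^sub>M p\<in>UNIV. borel)"
    using measurable_restrict[of UNIV "\<lambda>p \<omega>. case p of (i, j) \<Rightarrow> G \<omega> $ i $ j" M "\<lambda>_. borel"]
    by (simp add: case_prod_beta restrict_def)
  have "(\<Pi>\<^sub>M b\<in>(Basis :: (real^'c^'r) set). (gauss :: real measure)) =
      distr (\<Pi>\<^sub>M p\<in>(UNIV :: ('r \<times> 'c) set). gauss) (\<Pi>\<^sub>M b\<in>Basis. gauss) (\<lambda>f. \<lambda>b\<in>Basis. f (inv h b))"
    using bij gauss.prob_space_axioms[where 'a=real]
    by (intro distr_PiM_reindex[symmetric, where M="\<lambda>_. gauss"]) (auto simp: bij_betw_def)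
  also have "\<dots> = distr (\<Pi>\<^sub>M p\<in>(UNIV :: ('r \<times> 'c) set). gauss) (\<Pi>\<^sub>M b\<in>Basis. borel) (\<lambda>f. \<lambda>b\<in>Basis. f (inv h b))"
    by (intro distr_cong refl sets_PiM_cong) auto
  also have "\<dots> = distr M (\<Pi>\<^sub>M b\<in>Basis. borel) (\<lambda>\<omega>. \<lambda>b\<in>Basis. case inv h b of (i, j) \<Rightarrow> G \<omega> $ i $ j)"
    unfolding law[symmetric]
    by (subst distr_distr) (auto simp: comp_def intro!: measurable_restrict)
  also have "\<dots> = distr M (\<Pi>\<^sub>M b\<in>Basis. borel) (\<lambda>\<omega>. \<lambda>b\<in>Basis. G \<omega> \<bullet> b)"
    by (intro distr_cong refl) (auto simp: G_entry restrict_def)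
  finally show "distr M borel G = gauss"
    by (intro distr_eq_gaussI meas) simp
qed

lemma indep_rvs_distr:
  fixes X :: "'w \<Rightarrow> 'a::second_countable_topology" and Y :: "'w \<Rightarrow> 'b::second_countable_topology"
  assumes M: "prob_space M" and XY: "indep_rvs M X Y"
  shows "distr M (borel \<Otimes>\<^sub>M borel) (\<lambda>\<omega>. (X \<omega>, Y \<omega>)) = distr M borel X \<Otimes>\<^sub>M distr M borel Y"
proof -
  interpret prob_space M by fact
  have [measurable]: "X \<in> borel_measurable M" "Y \<in> borel_measurable M"
    and ind: "indep_set {X -` S \<inter> space M | S. S \<in> sets borel} {Y -` S \<inter> space M | S. S \<in> sets borel}"
    using XY by (auto simp: indep_rvs_def)
  interpret X: prob_space "distr M borel X" by (rule prob_space_distr) simp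
  interpret Y: prob_space "distr M borel Y" by (rule prob_space_distr) simp
  show ?thesis
  proof (rule pair_measure_eqI[symmetric])
    fix A B assume "A \<in> sets (distr M borel X)" "B \<in> sets (distr M borel Y)"
    then have [measurable]: "A \<in> sets borel" "B \<in> sets borel" by auto
    have "prob ((X -` A \<inter> space M) \<inter> (Y -` B \<inter> space M)) = prob (X -` A \<inter> space M) * prob (Y -` B \<inter> space M)"
      by (rule indep_setD[OF ind]) auto
    moreover have "(\<lambda>\<omega>. (X \<omega>, Y \<omega>)) -` (A \<times> B) \<inter> space M = (X -` A \<inter> space M) \<inter> (Y -` B \<inter> space M)"
      by auto
    ultimately show "emeasure (distr M borel X) A * emeasure (distr M borel Y) B =
        emeasure (distr M (borel \<Otimes>\<^sub>M borel) (\<lambda>\<omega>. (X \<omega>, Y \<omega>))) (A \<times> B)"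
      by (simp add: emeasure_distr emeasure_eq_measure ennreal_mult[symmetric])
  next
    show "sigma_finite_measure (distr M borel X)" "sigma_finite_measure (distr M borel Y)"
      by unfold_locales
    show "sets (distr M borel X \<Otimes>\<^sub>M distr M borel Y) =
        sets (distr M (borel \<Otimes>\<^sub>M borel) (\<lambda>\<omega>. (X \<omega>, Y \<omega>)))"
      unfolding sets_distr by (rule sets_pair_measure_cong) (rule sets_distr)+
  qed
qed

text \<open>By independence the pair of real and imaginary parts has law \<open>gauss\<close> on the
  product space, and \<open>L\<close>, which assembles a complex matrix from them, only relabels
  real coordinates and so preserves \<open>gauss\<close>.\<close>

lemma complex_std_normal_matrix_distr:
  fixes G :: "'w \<Rightarrow> complex^'c^'r"
  assumes M: "prob_space M" and G: "complex_std_normal_matrix M G"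
  shows "G \<in> borel_measurable M" "distr M borel G = gauss"
proof -
  let ?G1 = "\<lambda>\<omega>. \<chi> i j. Re (G \<omega> $ i $ j)" and ?G2 = "\<lambda>\<omega>. \<chi> i j. Im (G \<omega> $ i $ j)"
  have G1: "real_std_normal_matrix M ?G1" and G2: "real_std_normal_matrix M ?G2"
    and ind: "indep_rvs M ?G1 ?G2"
    using G by (auto simp: complex_std_normal_matrix_def Let_def)
  note m [measurable] = real_std_normal_matrix_distr(1)[OF M G1] real_std_normal_matrix_distr(1)[OF M G2]
  define L where "L = (\<lambda>z :: (real^'c^'r) \<times> (real^'c^'r). \<chi> i j. Complex (fst z $ i $ j) (snd z $ i $ j))"
  have lin: "linear L"
    by (intro linearI) (simp_all add: L_def vec_eq_iff complex_eq_iff)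
  have law: "distr gauss borel L = gauss"
  proof (rule distr_gauss_coisometry[OF lin, where L'="\<lambda>Z. (\<chi> i j. Re (Z $ i $ j), \<chi> i j. Im (Z $ i $ j))"])
    show "linear (\<lambda>Z :: complex^'c^'r. (\<chi> i j. Re (Z $ i $ j), \<chi> i j. Im (Z $ i $ j)))"
      by (intro linearI) (simp_all add: vec_eq_iff)
    show "inner (L x) y = inner x (\<chi> i j. Re (y $ i $ j), \<chi> i j. Im (y $ i $ j))" for x y
      by (simp add: L_def inner_vec_def inner_complex_def inner_prod_def sum.distrib)
    show "L (\<chi> i j. Re (y $ i $ j), \<chi> i j. Im (y $ i $ j)) = y" for y
      by (simp add: L_def vec_eq_iff)
  qed
  have GL: "G = (\<lambda>\<omega>. L (?G1 \<omega>, ?G2 \<omega>))"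
    by (simp add: L_def vec_eq_iff fun_eq_iff)
  have [measurable]: "L \<in> borel_measurable (borel \<Otimes>\<^sub>M borel)"
    using linear_borel_measurable[OF lin] by (simp add: borel_prod)
  show "G \<in> borel_measurable M"
    by (subst GL) measurable
  have "distr M borel G = distr (distr M (borel \<Otimes>\<^sub>M borel) (\<lambda>\<omega>. (?G1 \<omega>, ?G2 \<omega>))) borel L"
    by (subst distr_distr) (auto simp: comp_def GL[symmetric])
  also have "\<dots> = gauss"
    by (simp only: indep_rvs_distr[OF M ind] real_std_normal_matrix_distr(2)[OF M G1]
        real_std_normal_matrix_distr(2)[OF M G2] gauss_Pair law)
  finally show "distr M borel G = gauss" .
qed

section \<open>The pseudoinverse in the full-rank case and a majorant of the error\<close>

lemma is_pinv_unique:
  fixes A :: "'f::rc_field^'n^'m"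
  assumes "is_pinv A X" "is_pinv A Y"
  shows "X = Y"
proof -
  have X: "A ** X ** A = A" "X ** A ** X = X" "conj_transpose (A ** X) = A ** X" "conj_transpose (X ** A) = X ** A"
    and Y: "A ** Y ** A = A" "Y ** A ** Y = Y" "conj_transpose (A ** Y) = A ** Y" "conj_transpose (Y ** A) = Y ** A"
    using assms by (auto simp: is_pinv_def)
  \<comment> \<open>Penrose's argument: both factors are Hermitian, so taking adjoints reverses
    their order.\<close>
  have "A ** X = (A ** Y) ** (A ** X)" by (simp add: matrix_mul_assoc Y)
  then have "A ** X = (A ** X) ** (A ** Y)" by (metis conj_transpose_mult X(3) Y(3))
  then have 1: "A ** X = A ** Y" by (simp add: matrix_mul_assoc X)
  have "X ** A = (X ** A) ** (Y ** A)" by (metis matrix_mul_assoc Y(1))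
  then have "X ** A = (Y ** A) ** (X ** A)" by (metis conj_transpose_mult X(4) Y(4))
  then have 2: "X ** A = Y ** A" by (metis matrix_mul_assoc X(1))
  have "X = X ** A ** X" by (simp add: X)
  also have "\<dots> = Y ** A ** X" by (simp add: 2)
  also have "\<dots> = Y ** (A ** Y)" by (simp add: 1 matrix_mul_assoc[symmetric])
  also have "\<dots> = Y" by (simp add: matrix_mul_assoc Y)
  finally show ?thesis .
qed

text \<open>\<open>E\<close> inverts the Gram matrix and is Hermitian because that matrix is. The
  Penrose equations are then direct, and uniqueness determines \<open>pinv A\<close>.\<close>

lemma pinv_eq_full_column_rank:
  fixes A :: "'f::rc_field^'n^'m"
  assumes E: "E ** (conj_transpose A ** A) = mat 1"
  shows "pinv A = E ** conj_transpose A" and "conj_transpose E = E"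
proof -
  let ?N = "conj_transpose A ** A"
  have N: "conj_transpose ?N = ?N" by (simp add: conj_transpose_mult)
  have "conj_transpose E = E ** ?N ** conj_transpose E" by (simp add: E)
  also have "\<dots> = E ** conj_transpose (E ** ?N)"
    by (simp add: conj_transpose_mult matrix_mul_assoc)
  finally show h: "conj_transpose E = E" by (simp add: E)
  have "is_pinv A (E ** conj_transpose A)"
    using E by (simp add: is_pinv_def conj_transpose_mult h matrix_mul_assoc[symmetric])
  then show "pinv A = E ** conj_transpose A"
    unfolding pinv_def by (metis is_pinv_unique the_equality)
qed

text \<open>The solution of \<open>N ** X = R\<close> for invertible \<open>N\<close>, column by
  column from Cramer's rule. A quotient of determinants is visibly measurable in the
  entries.\<close>

definition cramer_solution :: "'f::field^'k^'k \<Rightarrow> 'f^'n^'k \<Rightarrow> 'f^'n^'k" where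
  "cramer_solution N R = (\<chi> r c. det (\<chi> i j. if j = r then R $ i $ c else N $ i $ j) / det N)"

lemma cramer_solution_eq:
  fixes N :: "'f::field^'k^'k"
  assumes E: "E ** N = mat 1"
  shows "det N \<noteq> 0" "cramer_solution N R = E ** R"
proof -
  show d: "det N \<noteq> 0"
    using E by (metis det_I det_mul mult_zero_right zero_neq_one)
  have NE: "N ** E = mat 1" using E by (simp add: matrix_left_right_inverse)
  have "(cramer_solution N R) $ r $ c = (E ** R) $ r $ c" for r c
  proof -
    have "N *v column c (E ** R) = column c R"
      by (simp add: column_mult matrix_vector_mul_assoc NE)
    then have "column c (E ** R) = (\<chi> k. det (\<chi> i j. if j = k then column c R $ i else N $ i $ j) / det N)"
      by (simp only: cramer[OF d])
    then have "column c (E ** R) $ r = det (\<chi> i j. if j = r then column c R $ i else N $ i $ j) / det N"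
      by simp
    then show ?thesis unfolding cramer_solution_def column_def by (simp cong: if_cong)
  qed
  then show "cramer_solution N R = E ** R" by (simp add: vec_eq_iff)
qed

text \<open>A measurable majorant of the squared error which agrees with it when \<open>\<Psi>Q\<close> has full column
  rank; it spares the measurability of \<open>pinv\<close>.\<close>

definition error_majorant :: "'f::rc_field^'n^'m \<Rightarrow> 'f^'k^'m \<Rightarrow> 'f^'m^'l \<Rightarrow> ennreal" where
  "error_majorant A Q \<Psi> = (let N = conj_transpose (\<Psi> ** Q) ** (\<Psi> ** Q) in
     if det N = 0 then \<infinity>
     else ennreal ((norm (A - Q ** cramer_solution N (conj_transpose (\<Psi> ** Q) ** (\<Psi> ** A))))\<^sup>2))"

lemma error_majorant_eq:
  assumes "E ** (conj_transpose (\<Psi> ** Q) ** (\<Psi> ** Q)) = mat 1"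
  shows "error_majorant A Q \<Psi> =
    ennreal ((norm (A - Q ** (E ** (conj_transpose (\<Psi> ** Q) ** (\<Psi> ** A)))))\<^sup>2)"
  using cramer_solution_eq(1)[OF assms] unfolding cramer_solution_eq(2)[OF assms, symmetric]
  by (simp add: error_majorant_def Let_def)

lemma error_le_error_majorant:
  "ennreal ((norm (A - Q ** (pinv (\<Psi> ** Q) ** (\<Psi> ** A))))\<^sup>2) \<le> error_majorant A Q \<Psi>"
proof (cases "det (conj_transpose (\<Psi> ** Q) ** (\<Psi> ** Q)) = 0")
  case False
  then obtain E where E: "E ** (conj_transpose (\<Psi> ** Q) ** (\<Psi> ** Q)) = mat 1"
    by (metis invertible_det_nz invertible_def)
  show ?thesis
    unfolding error_majorant_eq[OF E] pinv_eq_full_column_rank(1)[OF E]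
    by (simp add: matrix_mul_assoc)
qed (simp add: error_majorant_def)

section \<open>Measurability of matrix operations and of the majorant\<close>

lemma borel_measurable_vec_nth:
  fixes f :: "'x \<Rightarrow> 'f::euclidean_space^'n"
  assumes "f \<in> borel_measurable M"
  shows "(\<lambda>x. f x $ i) \<in> borel_measurable M"
  using borel_measurable_continuous_on[OF _ assms, of "\<lambda>v. v $ i"]
  by (simp add: continuous_on_component)

lemma borel_measurable_vecI:
  fixes f :: "'x \<Rightarrow> 'f::euclidean_space^'n"
  assumes "\<And>i. (\<lambda>x. f x $ i) \<in> borel_measurable M"
  shows "f \<in> borel_measurable M"
proof (subst borel_measurable_euclidean_space, intro ballI)
  fix b :: "'f^'n" assume "b \<in> Basis"
  then obtain i u where "b = axis i u" by (auto simp: Basis_vec_def)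
  then show "(\<lambda>x. f x \<bullet> b) \<in> borel_measurable M"
    using assms[of i] by (simp add: inner_axis)
qed

lemma borel_measurable_matrix_mult [measurable (raw)]:
  fixes f :: "'x \<Rightarrow> 'f::rc_field^'n^'m" and g :: "'x \<Rightarrow> 'f^'p^'n"
  assumes "f \<in> borel_measurable M" "g \<in> borel_measurable M"
  shows "(\<lambda>x. f x ** g x) \<in> borel_measurable M"
  unfolding matrix_matrix_mult_def
  by (intro borel_measurable_vecI) (simp, intro borel_measurable_sum borel_measurable_times borel_measurable_vec_nth assms)

lemma borel_measurable_conj_transpose [measurable (raw)]:
  fixes f :: "'x \<Rightarrow> 'f::rc_field^'n^'m"
  assumes "f \<in> borel_measurable M"
  shows "(\<lambda>x. conj_transpose (f x)) \<in> borel_measurable M"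
  using measurable_compose[OF assms linear_borel_measurable[OF linear_conj_transpose]] .

lemma borel_measurable_det:
  fixes f :: "'x \<Rightarrow> 'f::rc_field^'n^'n"
  assumes "\<And>i j. (\<lambda>x. f x $ i $ j) \<in> borel_measurable M"
  shows "(\<lambda>x. det (f x)) \<in> borel_measurable M"
  unfolding det_def by (intro borel_measurable_sum borel_measurable_times borel_measurable_prod assms) auto

lemma borel_measurable_cramer_solution [measurable (raw)]:
  fixes f :: "'x \<Rightarrow> 'f::rc_field^'k^'k" and g :: "'x \<Rightarrow> 'f^'n^'k"
  assumes "f \<in> borel_measurable M" "g \<in> borel_measurable M"
  shows "(\<lambda>x. cramer_solution (f x) (g x)) \<in> borel_measurable M"
proof -
  have "(\<lambda>x. (if j = r then g x $ i $ c else f x $ i $ j)) \<in> borel_measurable M" for i j r c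
    by (cases "j = r") (simp_all add: borel_measurable_vec_nth assms)
  then show ?thesis
    unfolding cramer_solution_def
    by (intro borel_measurable_vecI) (simp, intro borel_measurable_divide borel_measurable_det,
        simp_all add: borel_measurable_vec_nth assms)
qed

lemma borel_measurable_error_majorant [measurable (raw)]:
  fixes f :: "'x \<Rightarrow> 'f::rc_field^'k^'m" and g :: "'x \<Rightarrow> 'f^'m^'l"
  assumes [measurable]: "f \<in> borel_measurable M" "g \<in> borel_measurable M"
  shows "(\<lambda>x. error_majorant A (f x) (g x)) \<in> borel_measurable M"
proof -
  have [measurable]: "(\<lambda>x. det (conj_transpose (g x ** f x) ** (g x ** f x))) \<in> borel_measurable M"
    by (intro borel_measurable_det borel_measurable_vec_nth) measurable
  show ?thesis
    unfolding error_majorant_def Let_def by measurable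
qed

section \<open>The error bound\<close>

lemma fproj_columns:
  fixes Q :: "'f::rc_field^'k^'m"
  shows "fproj (\<lambda>j. column j Q) UNIV = Q ** conj_transpose Q"
  by (simp add: fproj_def outer_def vec_eq_iff column_def matrix_matrix_mult_def sum_component)

lemma orthonormal_family_columns:
  fixes Q :: "'f::rc_field^'k^'m"
  assumes "orthonormal_columns Q"
  shows "orthonormal_family (\<lambda>j. column j Q) UNIV"
proof -
  have "(conj_transpose Q ** Q) $ i $ j = hdot (column i Q) (column j Q)" for i j
    by (simp add: matrix_matrix_mult_def hdot_def column_def)
  then show ?thesis
    using assms by (simp add: orthonormal_family_def orthonormal_columns_def mat_def)
qed

text \<open>For \<open>b = DIM('f)\<close> the hypothesis reads \<open>\<alpha> = 2 / b - 1\<close>, which is 1 for the reals and 0 for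
  the complex numbers; this treats both fields at once.\<close>

lemma compression_factor_eq:
  fixes \<alpha> k r :: nat and b :: real
  assumes "b * (real \<alpha> + 1) = 2"
  shows "b * real r / (b * (real k + 1 - real r) - 2) = sketch_f \<alpha> r k"
proof -
  have "b * (real k + 1 - real r) - 2 = b * (real k - real r - real \<alpha>)"
    using assms by (simp add: algebra_simps)
  moreover have "b \<noteq> 0" using assms by auto
  ultimately show ?thesis by (simp add: sketch_f_def)
qed

text \<open>As \<open>b * (\<alpha> + 1) = 2\<close>, the left side is
  \<open>b * (r + \<alpha>) + b\<close>, so the claim is \<open>r + \<alpha> < k\<close> scaled by
  \<open>b\<close>.\<close>

lemma compression_dim_cond:
  fixes \<alpha> k r b :: nat
  assumes "real b * (real \<alpha> + 1) = 2" "r + \<alpha> < k"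
  shows "2 + b * r < b * (k + 1)"
proof -
  have "b * (\<alpha> + 1) = 2" using assms(1) by (metis of_nat_1 of_nat_add of_nat_eq_iff of_nat_mult of_nat_numeral)
  moreover from this have "b > 0" by (cases b) auto
  then have "b * (r + \<alpha>) < b * k" using assms(2) by simp
  ultimately show ?thesis by (simp add: algebra_simps)
qed

text \<open>The least-squares half, for fixed \<open>Q\<close>: the compression bound is applied to
  the adjoint of \<open>A\<close>, with the adjoint of \<open>\<Psi>\<close> as Gaussian matrix and
  the columns of \<open>Q\<close> as orthonormal family.\<close>

lemma nn_integral_error_majorant_le:
  fixes A :: "'f::rc_field^'n^'m" and Q :: "'f^'k^'m"
  assumes Q: "orthonormal_columns Q"
    and \<alpha>: "real DIM('f) * (real \<alpha> + 1) = 2" and kl: "CARD('k) + \<alpha> < CARD('l::finite)"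
  shows "(\<integral>\<^sup>+\<Psi>. error_majorant A Q (\<Psi> :: 'f^'m^'l) \<partial>gauss) \<le>
    ennreal ((1 + sketch_f \<alpha> CARD('k) CARD('l)) * (norm (A - Q ** conj_transpose Q ** A))\<^sup>2)"
proof -
  let ?v = "\<lambda>j. column j Q" and ?A = "conj_transpose A"
  let ?P = "Q ** conj_transpose Q"
  have QQ: "conj_transpose Q ** Q = mat 1" using Q by (simp add: orthonormal_columns_def)
  have "(\<integral>\<^sup>+\<Psi>. error_majorant A Q (\<Psi> :: 'f^'m^'l) \<partial>gauss) =
      (\<integral>\<^sup>+\<Psi>. error_majorant A Q (\<Psi> :: 'f^'m^'l) \<partial>distr gauss borel conj_transpose)"
    by (simp add: distr_gauss_conj_transpose)
  also have "\<dots> \<le> (\<integral>\<^sup>+\<Omega>. error_majorant A Q (conj_transpose (\<Omega> :: 'f^'l^'m)) \<partial>gauss)"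
    using linear_borel_measurable[OF linear_conj_transpose] by (intro nn_integral_distr_le) simp
  also have "\<dots> \<le> ennreal ((1 + DIM('f) * card (UNIV :: 'k set) /
      (real DIM('f) * (real CARD('l) + 1 - real (card (UNIV :: 'k set))) - 2)) *
      (norm (?A - ?A ** fproj ?v UNIV))\<^sup>2)"
  proof (rule nn_integral_compression_le[OF orthonormal_family_columns[OF Q] compression_dim_cond[OF \<alpha> kl]],
      unfold fproj_columns)
    fix \<Omega> :: "'f^'l^'m" and T :: "'f^'m^'l" and C :: "'f^'m^'m"
    assume TP: "T ** ?P = T" and PT: "?P ** \<Omega> ** T = ?P" and T: "T = conj_transpose \<Omega> ** ?P ** C"
    define N where "N = conj_transpose \<Omega> ** Q"
    define D where "D = conj_transpose Q ** C"
    have TD: "T = N ** D" by (simp add: T N_def D_def matrix_mul_assoc)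
    have 1: "conj_transpose Q = conj_transpose Q ** ?P"
      by (simp add: matrix_mul_assoc QQ)
    have "conj_transpose Q ** (?P ** \<Omega> ** T) = conj_transpose Q ** ?P"
      by (simp only: PT)
    moreover have "conj_transpose Q ** (?P ** \<Omega> ** T) = (conj_transpose Q ** ?P) ** \<Omega> ** N ** D"
      by (simp add: TD matrix_mul_assoc)
    moreover have "(conj_transpose Q ** ?P) ** \<Omega> = conj_transpose N"
      by (simp only: 1[symmetric]) (simp add: N_def conj_transpose_mult)
    ultimately have ND: "conj_transpose N ** N ** D = conj_transpose Q"
      by (simp only: 1[symmetric])
    then have "(conj_transpose N ** N) ** (D ** Q) = mat 1"
      by (simp add: matrix_mul_assoc QQ)
    \<comment> \<open>A square matrix with a right inverse is invertible, so the existence of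
      \<open>T\<close> forces \<open>N\<close>, which is \<open>\<Psi> ** Q\<close>, to have full
      column rank.\<close>
    then have E: "(D ** Q) ** (conj_transpose N ** N) = mat 1"
      by (simp only: matrix_left_right_inverse)
    define E where "E = D ** Q"
    note E = E[folded E_def]
    have hE: "conj_transpose E = E" by (rule pinv_eq_full_column_rank(2)[OF E])
    have "D = E ** (conj_transpose N ** N ** D)"
      using E by (simp add: matrix_mul_assoc)
    \<comment> \<open>Hence \<open>T = N ** E ** conj_transpose Q\<close>, whose adjoint is
      \<open>Q ** pinv N\<close>. The compression error is therefore the adjoint of the
      least-squares error.\<close>
    then have D: "D = E ** conj_transpose Q" by (simp only: ND)
    have "error_majorant A Q (conj_transpose \<Omega>) =
        ennreal ((norm (A - Q ** (E ** (conj_transpose N ** (conj_transpose \<Omega> ** A)))))\<^sup>2)"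
      using error_majorant_eq[of E "conj_transpose \<Omega>" Q A] E by (simp add: N_def)
    also have "norm (A - Q ** (E ** (conj_transpose N ** (conj_transpose \<Omega> ** A)))) =
        norm (conj_transpose (A - Q ** (E ** (conj_transpose N ** (conj_transpose \<Omega> ** A)))))"
      by simp
    also have "conj_transpose (A - Q ** (E ** (conj_transpose N ** (conj_transpose \<Omega> ** A)))) = ?A - ?A ** \<Omega> ** T"
      by (simp add: conj_transpose_diff conj_transpose_mult hE TD D matrix_mul_assoc)
    finally show "error_majorant A Q (conj_transpose \<Omega>) \<le> ennreal ((norm (?A - ?A ** \<Omega> ** T))\<^sup>2)"
      by simp
  qed
  also have "norm (?A - ?A ** fproj ?v UNIV) = norm (conj_transpose (A - ?P ** A))"
    by (simp add: conj_transpose_diff conj_transpose_mult fproj_columns matrix_mul_assoc del: norm_conj_transpose)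
  finally show ?thesis
    by (simp add: compression_factor_eq[OF \<alpha>])
qed

section \<open>Projection errors and the range finder\<close>

lemma norm_projection_residual_le:
  fixes A :: "'f::rc_field^'n^'m"
  assumes P: "conj_transpose P = P" "P ** P = P"
  shows "norm (A - P ** A) \<le> norm A"
proof -
  have "inner (A - P ** A) (P ** A) = inner (P ** (A - P ** A)) A"
    by (simp add: inner_matrix_mult_left P)
  also have "P ** (A - P ** A) = 0"
    by (simp add: matrix_mult_diff_left matrix_mul_assoc P)
  finally have "orthogonal (A - P ** A) (P ** A)" by (simp add: orthogonal_def)
  then have "(norm (A - P ** A + P ** A))\<^sup>2 = (norm (A - P ** A))\<^sup>2 + (norm (P ** A))\<^sup>2"
    by (rule norm_add_Pythagorean)
  then have "(norm (A - P ** A))\<^sup>2 \<le> (norm A)\<^sup>2" by simp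
  then show ?thesis by (rule power2_le_imp_le) simp
qed

lemma hdot_eq_0_of_fproj:
  fixes z :: "'f::rc_field^'n"
  assumes "fproj v J *v z = 0" "fproj v J *v s = s"
  shows "hdot z s = 0"
proof (rule hdot_eq_0I)
  fix c
  have "inner z (c *s s) = inner z (fproj v J *v (c *s s))"
    by (simp add: vector_scalar_commute assms(2))
  also have "\<dots> = inner (fproj v J *v z) (c *s s)"
    by (simp add: inner_matrix_vector_left)
  finally show "inner z (c *s s) = 0" by (simp add: assms(1))
qed

text \<open>Gram-Schmidt: the residual of the new vector is normalized and adjoined unless it
  vanishes. The family is a set indexed by its own elements, so its cardinality counts the
  vectors.\<close>

lemma orthonormal_family_exists:
  fixes S :: "('f::rc_field^'n) set"
  assumes "finite S"
  shows "\<exists>V. orthonormal_family (\<lambda>x. x) V \<and> card V \<le> card S \<and> (\<forall>s\<in>S. fproj (\<lambda>x. x) V *v s = s)"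
  using assms
proof (induction S rule: finite_induct)
  case empty
  then show ?case by (intro exI[of _ "{}"]) (auto simp: orthonormal_family_def)
next
  case (insert x S)
  then obtain V where V: "orthonormal_family (\<lambda>x. x) V" "card V \<le> card S"
    and S: "\<And>s. s \<in> S \<Longrightarrow> fproj (\<lambda>x. x) V *v s = s" by auto
  let ?P = "fproj (\<lambda>x. x) V"
  define z where "z = x - ?P *v x"
  show ?case
  proof (cases "z = 0")
    case True
    then show ?thesis
      using V S insert.hyps by (intro exI[of _ V]) (auto simp: z_def)
  next
    case False
    define w where "w = inverse (norm z) *\<^sub>R z"
    have Pz: "?P *v z = 0"
      by (simp add: z_def matrix_vector_mult_diff_distrib matrix_vector_mul_assoc fproj_idem[OF V(1)])
    have orth: "hdot w s = 0" if "?P *v s = s" for s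
      using hdot_eq_0_of_fproj[OF Pz that] by (simp add: w_def hdot_scaleR_left)
    have Vw: "hdot w u = 0" "hdot u w = 0" if "u \<in> V" for u
      using orth[OF fproj_mult_vector[OF V(1) that]] hdot_commute[of u w] by auto
    have ww: "hdot w w = 1"
      using False by (simp add: w_def hdot_self)
    have wV: "w \<notin> V" using Vw(1)[of w] ww by auto
    have fin: "finite V" using V(1) by (simp add: orthonormal_family_def)
    have P': "fproj (\<lambda>x. x) (insert w V) *v s = hdot w s *s w + ?P *v s" for s
      using wV fin by (simp add: fproj_def matrix_vector_mult_add_rdistrib outer_mult_vector)
    have "hdot w x = hdot w (?P *v x) + hdot w z"
      by (simp add: z_def hdot_add_right[symmetric])
    also have "hdot w (?P *v x) = 0"
      by (rule orth) (simp add: matrix_vector_mul_assoc fproj_idem[OF V(1)])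
    also have "hdot w z = norm z *\<^sub>R 1"
      using False by (simp add: w_def hdot_scaleR_left hdot_self power2_eq_square)
    finally have "hdot w x *s w = z"
      using False by (simp add: scaleR_eq_scale[symmetric]) (simp add: w_def)
    then have "fproj (\<lambda>x. x) (insert w V) *v x = x"
      by (simp add: P' z_def)
    moreover have "fproj (\<lambda>x. x) (insert w V) *v s = s" if "s \<in> S" for s
      using orth[OF S[OF that]] S[OF that] by (simp add: P')
    moreover have "orthonormal_family (\<lambda>x. x) (insert w V)"
      using V(1) Vw ww wV by (auto simp: orthonormal_family_def)
    moreover have "card (insert w V) \<le> card (insert x S)"
      using V(2) insert.hyps wV fin by simp
    ultimately show ?thesis by (intro exI[of _ "insert w V"]) auto
  qed
qed

lemma row_space_projection_exists:
  fixes B :: "'f::rc_field^'n^'m"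
  obtains V :: "('f^'n) set" where "orthonormal_family (\<lambda>x. x) V" "card V \<le> rank B" "B ** fproj (\<lambda>x. x) V = B"
proof -
  obtain S where S: "S \<subseteq> rows B" "rows B \<subseteq> vec.span S" "card S = rank B" and ind: "vec.independent S"
    unfolding row_rank_def_gen by (metis vec.basis_exists)
  have fin: "finite S" by (rule vec.finiteI_independent[OF ind])
  \<comment> \<open>The identity \<open>B ** ?P = B\<close> says that \<open>?P\<close> fixes the
    columns of the adjoint of \<open>B\<close>, which are the conjugated rows; so these are the
    vectors to be orthonormalized.\<close>
  define cv where "cv = (\<lambda>x :: 'f^'n. \<chi> i. conjugate (x $ i))"
  obtain V where V: "orthonormal_family (\<lambda>x. x) V" "card V \<le> card (cv ` S)"
    and PS: "\<And>s. s \<in> S \<Longrightarrow> fproj (\<lambda>x. x) V *v cv s = cv s"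
    using orthonormal_family_exists[of "cv ` S"] fin by blast
  let ?P = "fproj (\<lambda>x. x) V"
  have "?P *v column i (conj_transpose B) = column i (conj_transpose B)" for i
  proof -
    have "row i B \<in> vec.span S" using S(2) by (auto simp: rows_def)
    then obtain c where c: "row i B = (\<Sum>s\<in>S. c s *s s)"
      by (auto simp: vec.span_finite[OF fin])
    have "column i (conj_transpose B) = cv (row i B)"
      by (simp add: cv_def column_def row_def vec_eq_iff)
    also have "\<dots> = (\<Sum>s\<in>S. conjugate (c s) *s cv s)"
      by (simp add: c cv_def vec_eq_iff sum_component sum_conjugate fin conjugate_dist_mul)
    finally show ?thesis
      by (simp add: matrix_vector_mult_sum_scale PS)
  qed
  then have "column i (?P ** conj_transpose B) = column i (conj_transpose B)" for i
    by (simp add: column_mult)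
  then have "?P ** conj_transpose B = conj_transpose B"
    by (simp add: column_def vec_eq_iff)
  then have "conj_transpose (?P ** conj_transpose B) = B" by simp
  then have "B ** ?P = B" by (simp add: conj_transpose_mult)
  moreover have "card V \<le> rank B"
    using V(2) card_image_le[OF fin, of cv] S(3) by simp
  ultimately show ?thesis using V(1) by (intro that)
qed

text \<open>The compression bound with the projection onto the row space of the competitor
  \<open>B\<close>. It gives a bound through \<open>A - A ** P\<close>, which is no larger than
  \<open>A - B\<close>.\<close>

lemma nn_integral_range_error_le:
  fixes A B :: "'f::rc_field^'n^'m" and qr :: "'f^'k::{finite,linorder}^'m \<Rightarrow> 'f^'k::{finite,linorder}^'m"
  assumes qr: "\<And>Y. qr_factor Y (qr Y)"
    and \<alpha>: "real DIM('f) * (real \<alpha> + 1) = 2" and \<rho>: "\<rho> + \<alpha> < CARD('k)" and B: "rank B \<le> \<rho>"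
  shows "(\<integral>\<^sup>+\<Omega>. ennreal ((norm (A - qr (A ** \<Omega>) ** conj_transpose (qr (A ** \<Omega>)) ** A))\<^sup>2) \<partial>gauss) \<le>
    ennreal ((1 + sketch_f \<alpha> \<rho> CARD('k)) * (norm (A - B))\<^sup>2)"
proof -
  obtain V :: "('f^'n) set" where V: "orthonormal_family (\<lambda>x. x) V" "card V \<le> rank B" "B ** fproj (\<lambda>x. x) V = B"
    by (rule row_space_projection_exists)
  let ?P = "fproj (\<lambda>x. x) V"
  have V\<alpha>: "card V + \<alpha> < CARD('k)" using V(2) B \<rho> by simp
  have "(\<integral>\<^sup>+\<Omega>. ennreal ((norm (A - qr (A ** \<Omega>) ** conj_transpose (qr (A ** \<Omega>)) ** A))\<^sup>2) \<partial>gauss)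
    \<le> ennreal ((1 + DIM('f) * card V /
      (real DIM('f) * (real CARD('k) + 1 - real (card V)) - 2)) * (norm (A - A ** ?P))\<^sup>2)"
  proof (rule nn_integral_compression_le[OF V(1) compression_dim_cond[OF \<alpha> V\<alpha>]])
    fix \<Omega> :: "'f^'k::{finite,linorder}^'n" and T :: "'f^'n^'k::{finite,linorder}"
    let ?Q = "qr (A ** \<Omega>)"
    let ?R = "?Q ** conj_transpose ?Q"
    obtain R where QQ: "conj_transpose ?Q ** ?Q = mat 1" and R: "A ** \<Omega> = ?Q ** R"
      using qr[of "A ** \<Omega>"] by (auto simp: qr_factor_def orthonormal_columns_def)
    have "?R ** ?R = ?Q ** (conj_transpose ?Q ** ?Q) ** conj_transpose ?Q"
      by (simp only: matrix_mul_assoc)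
    then have RR: "conj_transpose ?R = ?R" "?R ** ?R = ?R"
      by (simp_all add: conj_transpose_mult QQ)
    have "?R ** (?Q ** R) = ?Q ** (conj_transpose ?Q ** ?Q) ** R"
      by (simp only: matrix_mul_assoc)
    then have "?R ** (A ** \<Omega>) = A ** \<Omega>"
      by (simp add: QQ flip: R)
    then have "?R ** (A ** \<Omega> ** T) = A ** \<Omega> ** T"
      by (simp only: matrix_mul_assoc)
    \<comment> \<open>The projection \<open>?R\<close> fixes \<open>A ** \<Omega> ** T\<close>, so
      subtracting it from \<open>A\<close> does not change the residual.\<close>
    then have "A - ?R ** A = (A - A ** \<Omega> ** T) - ?R ** (A - A ** \<Omega> ** T)"
      by (simp add: matrix_mult_diff_left)
    then have "norm (A - ?R ** A) \<le> norm (A - A ** \<Omega> ** T)"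
      using norm_projection_residual_le[OF RR, of "A - A ** \<Omega> ** T"] by (simp only:)
    then show "ennreal ((norm (A - ?R ** A))\<^sup>2) \<le> ennreal ((norm (A - A ** \<Omega> ** T))\<^sup>2)"
      by (intro ennreal_leI power_mono) auto
  qed
  also have "\<dots> \<le> ennreal ((1 + sketch_f \<alpha> \<rho> CARD('k)) * (norm (A - B))\<^sup>2)"
    unfolding of_nat_mult compression_factor_eq[OF \<alpha>]
  proof (intro ennreal_leI mult_mono power_mono add_left_mono)
    \<comment> \<open>The row space may have dimension below \<rho>; the factor increases with the
      dimension.\<close>
    show "sketch_f \<alpha> (card V) CARD('k) \<le> sketch_f \<alpha> \<rho> CARD('k)"
      using V(2) B \<rho> unfolding sketch_f_def by (intro frac_le) auto
    have PP: "conj_transpose ?P = ?P" "?P ** ?P = ?P" using V(1) by (auto simp: fproj_idem)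
    \<comment> \<open>As \<open>B ** ?P = B\<close>, the residual of \<open>A\<close> equals that of
      \<open>A - B\<close>, and a projection residual does not exceed the matrix in norm.\<close>
    have "norm (A - A ** ?P) = norm (conj_transpose ((A - B) - (A - B) ** ?P))"
      by (simp add: matrix_mult_diff_right V(3))
    also have "\<dots> = norm (conj_transpose (A - B) - ?P ** conj_transpose (A - B))"
      by (simp only: conj_transpose_diff conj_transpose_mult PP(1))
    also have "\<dots> \<le> norm (conj_transpose (A - B))"
      by (rule norm_projection_residual_le[OF PP])
    finally show "norm (A - A ** ?P) \<le> norm (A - B)" by simp
    show "0 \<le> 1 + sketch_f \<alpha> \<rho> CARD('k)"
      using \<rho> by (simp add: sketch_f_def)
  qed auto
  finally show ?thesis .
qed

text \<open>A bound against every competitor passes to the infimum after division by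
  \<open>c\<close>. For \<open>j > 0\<close> the zero matrix is a competitor, so the infimum is over
  a nonempty set and \<open>x\<close> is finite.\<close>

lemma ennreal_le_tail_energyI:
  fixes A :: "'f::rc_field^'n^'m"
  assumes c: "c > 0" and le: "\<And>B. rank B < j \<Longrightarrow> x \<le> ennreal (c * (norm (A - B))\<^sup>2)" and j: "j > 0"
  shows "x \<le> ennreal (c * tail_energy_sq j A)"
proof -
  have "rank (0 :: 'f^'n^'m) = 0"
    by (auto simp: row_rank_def_gen rows_def row_def zero_vec_def[symmetric])
  then have ne: "{B :: 'f^'n^'m. rank B < j} \<noteq> {}" using j by (metis empty_iff mem_Collect_eq)
  then obtain B0 :: "'f^'n^'m" where "rank B0 < j" by auto
  then have "x \<le> ennreal (c * (norm (A - B0))\<^sup>2)" by (rule le)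
  then have "x < top" by (meson ennreal_less_top order_le_less_trans)
  then obtain e where e: "e \<ge> 0" "x = ennreal e" by (cases x) auto
  have "e / c \<le> tail_energy_sq j A"
    unfolding tail_energy_sq_def
  proof (rule cINF_greatest[OF ne])
    fix B :: "'f^'n^'m" assume "B \<in> {B. rank B < j}"
    then have "ennreal e \<le> ennreal (c * (norm (A - B))\<^sup>2)" using le e by auto
    then have "e \<le> c * (norm (A - B))\<^sup>2" using c by (subst (asm) ennreal_le_iff) auto
    then show "e / c \<le> (norm (A - B))\<^sup>2" using c by (simp add: field_simps)
  qed
  then show ?thesis using c by (simp add: e field_simps ennreal_leI)
qed

text \<open>By independence the pair has the product law. Integrating over \<open>\<Psi>\<close>
  first, with \<open>Q\<close> fixed by \<open>\<Omega>\<close>, costs the factor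
  \<open>1 + sketch_f \<alpha> CARD('k) CARD('l)\<close> and leaves the range error, which is
  bounded for each \<rho>.\<close>

lemma sketch_error_bound:
  fixes A :: "'f::rc_field^'n^'m" and qr :: "'f^'k::{finite,linorder}^'m \<Rightarrow> 'f^'k::{finite,linorder}^'m"
    and \<Omega> :: "'w \<Rightarrow> 'f^'k::{finite,linorder}^'n" and \<Psi> :: "'w \<Rightarrow> 'f^'m^'l"
  assumes M: "prob_space M" and qr: "qr_procedure qr"
    and \<alpha>: "real DIM('f) * (real \<alpha> + 1) = 2" and kl: "CARD('k) + \<alpha> < CARD('l)"
    and \<Omega>: "distr M borel \<Omega> = gauss" and \<Psi>: "distr M borel \<Psi> = gauss" and ind: "indep_rvs M \<Omega> \<Psi>"
  shows "(\<integral>\<^sup>+\<omega>. ennreal ((norm (A - sketch_approx qr A (\<Omega> \<omega>) (\<Psi> \<omega>)))\<^sup>2) \<partial>M)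
      \<le> ennreal (1 + sketch_f \<alpha> CARD('k) CARD('l)) *
        (INF \<rho>\<in>{\<rho>. 1 \<le> \<rho> \<and> \<rho> + \<alpha> < CARD('k)}.
           ennreal ((1 + sketch_f \<alpha> \<rho> CARD('k)) * tail_energy_sq (\<rho> + 1) A))"
    (is "_ \<le> ennreal ?c * ?inf")
proof -
  let ?H = "\<lambda>z. error_majorant A (qr (A ** fst z)) (snd z :: 'f^'m^'l)"
  let ?E = "\<lambda>\<Omega>. (norm (A - qr (A ** \<Omega>) ** conj_transpose (qr (A ** \<Omega>)) ** A))\<^sup>2"
  have [measurable]: "qr \<in> borel_measurable borel" and fac: "\<And>Y. qr_factor Y (qr Y)"
    using qr by (auto simp: qr_procedure_def)
  have [measurable]: "\<Omega> \<in> borel_measurable M" "\<Psi> \<in> borel_measurable M"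
    using ind by (auto simp: indep_rvs_def)
  have qrm [measurable]: "(\<lambda>x. qr (A ** f x)) \<in> borel_measurable N"
    if [measurable]: "f \<in> borel_measurable N" for f and N :: "'y measure"
    by (rule measurable_compose[of _ _ borel]) measurable
  \<comment> \<open>Passing from \<open>M\<close> to the law of the pair is the direction opposite
    to \<open>nn_integral_distr_le\<close>. Here measurability is essential, of the majorant and of
    \<open>qr\<close>.\<close>
  have Hm: "?H \<in> borel_measurable (borel \<Otimes>\<^sub>M borel)"
    by (intro borel_measurable_error_majorant qrm) measurable
  have c: "?c \<ge> 0" using kl by (simp add: sketch_f_def)
  have "(\<integral>\<^sup>+\<omega>. ennreal ((norm (A - sketch_approx qr A (\<Omega> \<omega>) (\<Psi> \<omega>)))\<^sup>2) \<partial>M) \<le>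
      (\<integral>\<^sup>+\<omega>. ?H (\<Omega> \<omega>, \<Psi> \<omega>) \<partial>M)"
    by (intro nn_integral_mono) (simp add: sketch_approx_def Let_def error_le_error_majorant)
  also have "\<dots> = (\<integral>\<^sup>+z. ?H z \<partial>distr M (borel \<Otimes>\<^sub>M borel) (\<lambda>\<omega>. (\<Omega> \<omega>, \<Psi> \<omega>)))"
    by (rule nn_integral_distr[symmetric]) (use Hm in auto)
  also have "\<dots> = (\<integral>\<^sup>+z. ?H z \<partial>(gauss \<Otimes>\<^sub>M gauss))"
    by (simp only: indep_rvs_distr[OF M ind] \<Omega> \<Psi>)
  also have "\<dots> \<le> (\<integral>\<^sup>+x. \<integral>\<^sup>+y. ?H (x, y) \<partial>gauss \<partial>gauss)"
    by (rule gauss.nn_integral_pair_le)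
  also have "\<dots> \<le> (\<integral>\<^sup>+x. ennreal ?c * ennreal (?E x) \<partial>gauss)"
  proof (rule nn_integral_mono)
    fix x :: "'f^'k::{finite,linorder}^'n"
    have "orthonormal_columns (qr (A ** x))" using fac by (simp add: qr_factor_def)
    then show "(\<integral>\<^sup>+y. ?H (x, y) \<partial>gauss) \<le> ennreal ?c * ennreal (?E x)"
      using nn_integral_error_majorant_le[OF _ \<alpha> kl, of "qr (A ** x)" A] c
      by (simp add: ennreal_mult)
  qed
  also have "\<dots> = ennreal ?c * (\<integral>\<^sup>+x. ennreal (?E x) \<partial>gauss)"
    by (rule nn_integral_cmult) measurable
  also have "\<dots> \<le> ennreal ?c * ?inf"
  \<comment> \<open>The mean range error does not involve \<rho>, so it lies below the infimum; over
    an empty range the infimum is \<open>\<infinity>\<close>.\<close>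
  proof (intro mult_left_mono INF_greatest)
    fix \<rho> assume "\<rho> \<in> {\<rho>. 1 \<le> \<rho> \<and> \<rho> + \<alpha> < CARD('k)}"
    then have \<rho>: "\<rho> + \<alpha> < CARD('k)" by simp
    show "(\<integral>\<^sup>+x. ennreal (?E x) \<partial>gauss) \<le> ennreal ((1 + sketch_f \<alpha> \<rho> CARD('k)) * tail_energy_sq (\<rho> + 1) A)"
    proof (rule ennreal_le_tail_energyI)
      show "1 + sketch_f \<alpha> \<rho> CARD('k) > 0"
        using \<rho> by (intro add_pos_nonneg) (auto simp: sketch_f_def)
    qed (auto intro!: nn_integral_range_error_le fac \<alpha> \<rho>)
  qed simp
  finally show ?thesis .
qed

lemma one_plus_sketch_f:
  assumes "s + \<alpha> < t"
  shows "1 + sketch_f \<alpha> s t = (real t - real \<alpha>) / (real t - real s - real \<alpha>)"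
proof -
  have "real t - real s - real \<alpha> > 0" using assms by simp
  then show ?thesis by (simp add: sketch_f_def field_simps)
qed

lemma sketch_bound_eq:
  assumes "k + \<alpha> < l"
  shows "ennreal (1 + sketch_f \<alpha> k l) *
      (INF \<rho>\<in>{\<rho>. 1 \<le> \<rho> \<and> \<rho> + \<alpha> < k}. ennreal ((1 + sketch_f \<alpha> \<rho> k) * \<tau> \<rho>))
    = ennreal ((real l - real \<alpha>) / (real l - real k - real \<alpha>)) *
      (INF \<rho>\<in>{\<rho>. 1 \<le> \<rho> \<and> \<rho> + \<alpha> < k}.
         ennreal ((real k - real \<alpha>) / (real k - real \<rho> - real \<alpha>) * \<tau> \<rho>))"
  using assms by (intro arg_cong2[where f="(*)"] INF_cong) (auto simp: one_plus_sketch_f)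

theorem theorem4p3:
  fixes M :: "'w measure" and m n k l :: nat
  assumes "prob_space M"
    and "m = CARD('m::finite)" and "n = CARD('n::finite)"
    and "k = CARD('k::{finite,linorder})" and "l = CARD('l::finite)"
    and "k \<le> n" and "l \<le> m"
  shows
    "(let \<alpha> = 1 in
       \<forall>(A :: real^'n^'m) (qr :: real^'k::{finite,linorder}^'m \<Rightarrow> real^'k::{finite,linorder}^'m)
        (\<Omega> :: 'w \<Rightarrow> real^'k::{finite,linorder}^'n) (\<Psi> :: 'w \<Rightarrow> real^'m^'l).
         l > k + \<alpha> \<longrightarrow> qr_procedure qr \<longrightarrow>
         real_std_normal_matrix M \<Omega> \<longrightarrow> real_std_normal_matrix M \<Psi> \<longrightarrow>
         indep_rvs M \<Omega> \<Psi> \<longrightarrow>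
         (\<integral>\<^sup>+\<omega>. ennreal ((norm (A - sketch_approx qr A (\<Omega> \<omega>) (\<Psi> \<omega>)))\<^sup>2) \<partial>M)
           \<le> ennreal (1 + sketch_f \<alpha> k l) *
              (INF \<rho>\<in>{\<rho>. 1 \<le> \<rho> \<and> \<rho> + \<alpha> < k}.
                 ennreal ((1 + sketch_f \<alpha> \<rho> k) * tail_energy_sq (\<rho> + 1) A)) \<and>
         ennreal (1 + sketch_f \<alpha> k l) *
              (INF \<rho>\<in>{\<rho>. 1 \<le> \<rho> \<and> \<rho> + \<alpha> < k}.
                 ennreal ((1 + sketch_f \<alpha> \<rho> k) * tail_energy_sq (\<rho> + 1) A))
           = ennreal ((real l - real \<alpha>) / (real l - real k - real \<alpha>)) *
              (INF \<rho>\<in>{\<rho>. 1 \<le> \<rho> \<and> \<rho> + \<alpha> < k}.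
                 ennreal ((real k - real \<alpha>) / (real k - real \<rho> - real \<alpha>)
                            * tail_energy_sq (\<rho> + 1) A)))
     \<and>
     (let \<alpha> = 0 in
       \<forall>(A :: complex^'n^'m) (qr :: complex^'k::{finite,linorder}^'m \<Rightarrow> complex^'k::{finite,linorder}^'m)
        (\<Omega> :: 'w \<Rightarrow> complex^'k::{finite,linorder}^'n) (\<Psi> :: 'w \<Rightarrow> complex^'m^'l).
         l > k + \<alpha> \<longrightarrow> qr_procedure qr \<longrightarrow>
         complex_std_normal_matrix M \<Omega> \<longrightarrow> complex_std_normal_matrix M \<Psi> \<longrightarrow>
         indep_rvs M \<Omega> \<Psi> \<longrightarrow>
         (\<integral>\<^sup>+\<omega>. ennreal ((norm (A - sketch_approx qr A (\<Omega> \<omega>) (\<Psi> \<omega>)))\<^sup>2) \<partial>M)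
           \<le> ennreal (1 + sketch_f \<alpha> k l) *
              (INF \<rho>\<in>{\<rho>. 1 \<le> \<rho> \<and> \<rho> + \<alpha> < k}.
                 ennreal ((1 + sketch_f \<alpha> \<rho> k) * tail_energy_sq (\<rho> + 1) A)) \<and>
         ennreal (1 + sketch_f \<alpha> k l) *
              (INF \<rho>\<in>{\<rho>. 1 \<le> \<rho> \<and> \<rho> + \<alpha> < k}.
                 ennreal ((1 + sketch_f \<alpha> \<rho> k) * tail_energy_sq (\<rho> + 1) A))
           = ennreal ((real l - real \<alpha>) / (real l - real k - real \<alpha>)) *
              (INF \<rho>\<in>{\<rho>. 1 \<le> \<rho> \<and> \<rho> + \<alpha> < k}.
                 ennreal ((real k - real \<alpha>) / (real k - real \<rho> - real \<alpha>)
                            * tail_energy_sq (\<rho> + 1) A)))"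
proof -
  \<comment> \<open>The equation \<open>DIM('f) * (\<alpha> + 1) = 2\<close> reads
    \<open>1 * (1 + 1) = 2\<close> for the reals and \<open>2 * (0 + 1) = 2\<close> for the complex
    numbers.\<close>
  have real: "(\<integral>\<^sup>+\<omega>. ennreal ((norm (A - sketch_approx qr A (\<Omega> \<omega>) (\<Psi> \<omega>)))\<^sup>2) \<partial>M)
      \<le> ennreal (1 + sketch_f 1 k l) *
        (INF \<rho>\<in>{\<rho>. 1 \<le> \<rho> \<and> \<rho> + 1 < k}. ennreal ((1 + sketch_f 1 \<rho> k) * tail_energy_sq (\<rho> + 1) A))"
    if "k + 1 < l" "qr_procedure qr" "real_std_normal_matrix M \<Omega>" "real_std_normal_matrix M \<Psi>"
      "indep_rvs M \<Omega> \<Psi>"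
    for A :: "real^'n^'m" and qr :: "real^'k::{finite,linorder}^'m \<Rightarrow> real^'k::{finite,linorder}^'m"
      and \<Omega> :: "'w \<Rightarrow> real^'k::{finite,linorder}^'n" and \<Psi> :: "'w \<Rightarrow> real^'m^'l"
    unfolding assms(4,5)
    by (rule sketch_error_bound)
       (use that assms real_std_normal_matrix_distr(2)[OF assms(1)] in auto)
  have complex: "(\<integral>\<^sup>+\<omega>. ennreal ((norm (A - sketch_approx qr A (\<Omega> \<omega>) (\<Psi> \<omega>)))\<^sup>2) \<partial>M)
      \<le> ennreal (1 + sketch_f 0 k l) *
        (INF \<rho>\<in>{\<rho>. 1 \<le> \<rho> \<and> \<rho> + 0 < k}. ennreal ((1 + sketch_f 0 \<rho> k) * tail_energy_sq (\<rho> + 1) A))"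
    if "k + 0 < l" "qr_procedure qr" "complex_std_normal_matrix M \<Omega>" "complex_std_normal_matrix M \<Psi>"
      "indep_rvs M \<Omega> \<Psi>"
    for A :: "complex^'n^'m" and qr :: "complex^'k::{finite,linorder}^'m \<Rightarrow> complex^'k::{finite,linorder}^'m"
      and \<Omega> :: "'w \<Rightarrow> complex^'k::{finite,linorder}^'n" and \<Psi> :: "'w \<Rightarrow> complex^'m^'l"
    unfolding assms(4,5)
    by (rule sketch_error_bound)
       (use that assms complex_std_normal_matrix_distr(2)[OF assms(1)] in auto)
  show ?thesis
    unfolding Let_def by (intro conjI allI impI; (rule real complex sketch_bound_eq; assumption)?)
qed

end
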